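(* Let $f\in C(\overline{\mathbb{B}})$ and suppose there exists a constant $\omega>0$ such that $t^pf(t,x)\ge\omega$ for all $(t,x)\in\mathbb{B}$. Consider the equation $$t^{-p}\,\mathrm{div}_{\mathbb{B}}(|\nabla_{\mathbb{B}}w|^{p-2}\nabla_{\mathbb{B}}w)+t^{-p}(n-p)|\nabla_{\mathbb{B}}w|^{p-2}(t\partial_t w)=f(t,x)\quad\text{in }\mathbb{B}.\qquad( * )$$ Let $u\in USC(\overline{\mathbb{B}})$ be a viscosity subsolution of $( * )$ such that $\lim_{t\to0}\sup u$ exists, and let $v\in LSC(\overline{\mathbb{B}})$ be a viscosity supersolution of $( * )$ such that $\lim_{t\to0}\inf v$ exists. Assume in addition that $\lim_{t\to0}\sup u\le\lim_{t\to0}\inf v$ and that $v$ is bounded from above. If $u\le v$ on $\partial\mathbb{B}$, then $u\le v$ in $\mathbb{B}$.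
   Context: Setting: $n\ge 2$, $p\ge 2$; $X\subset\mathbb{R}^{n-1}$ is a bounded connected open set with smooth boundary; $\mathbb{B}=(0,1)\times X$ with points $(t,x)$; $\partial\mathbb{B}:=\{1\}\times X\cup(0,1]\times\partial X$ (the part $t=0$ is not included) and $\overline{\mathbb{B}}=\mathbb{B}\cup\partial\mathbb{B}$. $USC$/$LSC$ denote (real-valued) upper/lower semicontinuous functions. $\nabla_{\mathbb{B}}=(t\partial_t,\partial_{x_1},\dots,\partial_{x_{n-1}})$, $\mathrm{div}_{\mathbb{B}}=\nabla_{\mathbb{B}}\cdot$, and $\nabla^2_{\mathbb{B}}u$ is the matrix of second derivatives built from the operators $t\partial_t,\partial_{x_1},\dots,\partial_{x_{n-1}}$ (first entry $(t\partial_t)^2u$, mixed entries $t\partial_t\partial_{x_i}u$, and $\partial_{x_i}\partial_{x_j}u$). $\lim_{t\to0}\sup u$ is the upper limit $\lim_{r\to0^+}\sup\{u(t,x):(t,x)\in\overline{\mathbb{B}},\,0<t<r\}$ and $\lim_{t\to0}\inf v$ is the analogous lower limit; "exists" means it is a real number. Viscosity sub/supersolutions: put $F((t,x),P,A)=t^{-p}\big(|P|^{p-2}\mathrm{tr}A+(p-2)|P|^{p-4}\langle AP,P\rangle+(n-p)|P|^{p-2}P_1\big)-f(t,x)$ for $P\in\mathbb{R}^n$, $A$ symmetric (extended continuously at $P=0$). An upper (resp. lower) semicontinuous $w$ is a viscosity subsolution (resp. supersolution) if for every $\phi\in C^2(\mathbb{B})$ and every local maximum (resp. minimum) point $(t_0,x_0)\in\mathbb{B}$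 of $w-\phi$ one has $F((t_0,x_0),\nabla_{\mathbb{B}}\phi(t_0,x_0),\nabla^2_{\mathbb{B}}\phi(t_0,x_0))\ge 0$ (resp. $\le 0$). *)

theory Defs
  imports "HOL-Analysis.Analysis"
begin

text \<open>
  Points of the stretched cone are pairs \<open>(t, x)\<close> of type \<open>real \<times> (real ^ 'm)\<close>, so that \<open>n - 1 = CARD('m)\<close>
  (hence \<open>n \<ge> 2\<close>). Gradients and Hessians are indexed by \<open>'m option\<close>, where \<open>None\<close> is the
  \<open>t\<close>-direction and \<open>Some i\<close> the direction \<open>x\<^sub>i\<close>; thus \<open>n = CARD('m option)\<close>.
\<close>

text \<open>
  \<open>k\<close> times continuously differentiable on \<open>S\<close>; only meaningful for open \<open>S\<close>.
\<close>

primrec Ck_on :: "nat \<Rightarrow> 'a::euclidean_space set \<Rightarrow> ('a \<Rightarrow> real) \<Rightarrow> bool" where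
  "Ck_on 0 S f \<longleftrightarrow> continuous_on S f"
| "Ck_on (Suc k) S f \<longleftrightarrow> (\<forall>x\<in>S. f differentiable (at x)) \<and>
     (\<forall>b\<in>Basis. Ck_on k S (\<lambda>x. frechet_derivative f (at x) b))"

definition smooth_on :: "'a::euclidean_space set \<Rightarrow> ('a \<Rightarrow> real) \<Rightarrow> bool" where
  "smooth_on S f \<longleftrightarrow> (\<forall>k. Ck_on k S f)"

text \<open>Smoothness of the boundary of an open set, by local defining functions.\<close>

definition smooth_boundary :: "'a::euclidean_space set \<Rightarrow> bool" where
  "smooth_boundary X \<longleftrightarrow> (\<forall>y\<in>frontier X. \<exists>U \<rho>. open U \<and> y \<in> U \<and> smooth_on U \<rho> \<and>
     frechet_derivative \<rho> (at y) \<noteq> (\<lambda>_. 0) \<and> X \<inter> U = {x\<in>U. \<rho> x < 0})"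

definition cone_dom :: "(real ^ 'm) set \<Rightarrow> (real \<times> (real ^ 'm)) set" where
  "cone_dom X = {0<..<1} \<times> X"

text \<open>The face \<open>t = 0\<close> belongs neither to the boundary nor to the closure used here.\<close>

definition cone_boundary :: "(real ^ 'm) set \<Rightarrow> (real \<times> (real ^ 'm)) set" where
  "cone_boundary X = {1} \<times> X \<union> {0<..1} \<times> frontier X"

definition cone_closure :: "(real ^ 'm) set \<Rightarrow> (real \<times> (real ^ 'm)) set" where
  "cone_closure X = cone_dom X \<union> cone_boundary X"

definition usc_on :: "'a::topological_space set \<Rightarrow> ('a \<Rightarrow> real) \<Rightarrow> bool" where
  "usc_on S w \<longleftrightarrow> (\<forall>z\<in>S. \<forall>a>w z. \<forall>\<^sub>F y in at z within S. w y < a)"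

definition lsc_on :: "'a::topological_space set \<Rightarrow> ('a \<Rightarrow> real) \<Rightarrow> bool" where
  "lsc_on S w \<longleftrightarrow> (\<forall>z\<in>S. \<forall>a<w z. \<forall>\<^sub>F y in at z within S. a < w y)"

text \<open>
  The suprema and infima are extended-real valued; \<open>L\<close> being real expresses that the limit exists.
\<close>

definition has_upper_limit_t0 ::
  "(real ^ 'm) set \<Rightarrow> (real \<times> (real ^ 'm) \<Rightarrow> real) \<Rightarrow> real \<Rightarrow> bool" where
  "has_upper_limit_t0 X u L \<longleftrightarrow>
     ((\<lambda>r. SUP z\<in>{z\<in>cone_closure X. 0 < fst z \<and> fst z < r}. ereal (u z)) \<longlongrightarrow> ereal L) (at_right 0)"

definition has_lower_limit_t0 ::
  "(real ^ 'm) set \<Rightarrow> (real \<times> (real ^ 'm) \<Rightarrow> real) \<Rightarrow> real \<Rightarrow> bool" where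
  "has_lower_limit_t0 X v L \<longleftrightarrow>
     ((\<lambda>r. INF z\<in>{z\<in>cone_closure X. 0 < fst z \<and> fst z < r}. ereal (v z)) \<longlongrightarrow> ereal L) (at_right 0)"

text \<open>The operators \<open>t \<partial>\<^sub>t, \<partial>\<^sub>x\<^sub>1, \<dots>, \<partial>\<^sub>x\<^sub>n\<^sub>-\<^sub>1\<close>.\<close>

primrec D_B :: "'m option \<Rightarrow> (real \<times> (real ^ 'm::finite) \<Rightarrow> real) \<Rightarrow> real \<times> (real ^ 'm) \<Rightarrow> real" where
  "D_B None \<phi> = (\<lambda>z. fst z * frechet_derivative \<phi> (at z) (1, 0))"
| "D_B (Some i) \<phi> = (\<lambda>z. frechet_derivative \<phi> (at z) (0, axis i 1))"

definition grad_B :: "(real \<times> (real ^ 'm::finite) \<Rightarrow> real) \<Rightarrow> real \<times> (real ^ 'm) \<Rightarrow> real ^ ('m option)" where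
  "grad_B \<phi> z = (\<chi> i. D_B i \<phi> z)"

definition hess_B ::
  "(real \<times> (real ^ 'm::finite) \<Rightarrow> real) \<Rightarrow> real \<times> (real ^ 'm) \<Rightarrow> real ^ ('m option) ^ ('m option)" where
  "hess_B \<phi> z = (\<chi> i j. D_B i (D_B j \<phi>) z)"

text \<open>
  The expanded form, for a gradient \<open>P \<noteq> 0\<close> and Hessian \<open>A\<close>, of
  \<open>div\<^sub>B (|\<nabla>\<^sub>B w|\<^bsup>p-2\<^esup> \<nabla>\<^sub>B w) + (n - p) |\<nabla>\<^sub>B w|\<^bsup>p-2\<^esup> (t \<partial>\<^sub>t w)\<close>, the cone-degenerate
  \<open>p\<close>-Laplacian without its weight \<open>t\<^bsup>-p\<^esup>\<close>.
\<close>

definition pLap_nz ::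
  "real \<Rightarrow> real ^ ('m::finite option) \<Rightarrow> real ^ ('m option) ^ ('m option) \<Rightarrow> real" where
  "pLap_nz p P A =
     norm P powr (p - 2) * trace A
     + (p - 2) * norm P powr (p - 4) * ((A *v P) \<bullet> P)
     + (real CARD('m option) - p) * norm P powr (p - 2) * (P $ None)"

text \<open>
  At \<open>P = 0\<close> the expression is extended by continuity. Since \<open>0 powr a = 0\<close> for every \<open>a\<close>,
  plugging in \<open>P = 0\<close> would give the wrong value for \<open>p = 2\<close>.
\<close>

definition pLap ::
  "real \<Rightarrow> real ^ ('m::finite option) \<Rightarrow> real ^ ('m option) ^ ('m option) \<Rightarrow> real" where
  "pLap p P A = (if P = 0 then Lim (at 0) (\<lambda>Q. pLap_nz p Q A) else pLap_nz p P A)"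

lemma tendsto_pLap_nz_0:
  fixes A :: "real ^ ('m::finite option) ^ ('m option)"
  assumes "p \<ge> 2"
  shows "((\<lambda>Q. pLap_nz p Q A) \<longlongrightarrow> (if p = 2 then trace A else 0)) (at 0)"
proof (cases "p = 2")
  case True
  have "((\<lambda>Q::real ^ ('m option). trace A + (real CARD('m option) - 2) * (Q $ None)) \<longlongrightarrow>
        trace A + (real CARD('m option) - 2) * ((0::real ^ ('m option)) $ None)) (at 0)"
    by (intro tendsto_intros)
  moreover have "\<forall>\<^sub>F Q in at 0. trace A + (real CARD('m option) - 2) * (Q $ None) = pLap_nz p Q A"
    unfolding eventually_at_filter
    by (intro always_eventually) (simp add: pLap_nz_def True)
  ultimately show ?thesis
    using True by (auto elim: Lim_transform_eventually)
next
  case False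
  with assms have p: "p > 2" by simp
  have pw: "((\<lambda>Q::real ^ ('m option). norm Q powr (p - 2)) \<longlongrightarrow> 0) (at 0)"
    using p by (intro tendsto_eq_intros refl tendsto_powr') (auto intro!: tendsto_eq_intros)
  obtain K where K: "\<And>Q. norm (A *v Q) \<le> norm Q * K"
    using bounded_linear.bounded[OF matrix_vector_mul_bounded_linear[of A]] by blast
  have mid: "((\<lambda>Q. norm Q powr (p - 4) * ((A *v Q) \<bullet> Q)) \<longlongrightarrow> 0) (at 0)"
  proof (rule Lim_null_comparison)
    show "\<forall>\<^sub>F Q in at 0. norm (norm Q powr (p - 4) * ((A *v Q) \<bullet> Q)) \<le> K * norm Q powr (p - 2)"
      unfolding eventually_at_filter
    proof (intro always_eventually allI impI)
      fix Q :: "real ^ ('m option)" assume "Q \<noteq> 0"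
      have "\<bar>(A *v Q) \<bullet> Q\<bar> \<le> norm (A *v Q) * norm Q" by (rule Cauchy_Schwarz_ineq2)
      also have "\<dots> \<le> norm Q * K * norm Q" using K by (intro mult_right_mono) auto
      finally have "norm Q powr (p - 4) * \<bar>(A *v Q) \<bullet> Q\<bar> \<le> norm Q powr (p - 4) * (norm Q * K * norm Q)"
        by (intro mult_left_mono) auto
      also have "\<dots> = K * (norm Q powr (p - 4) * norm Q powr 2)"
        using \<open>Q \<noteq> 0\<close> by (simp add: power2_eq_square)
      also have "\<dots> = K * norm Q powr (p - 2)"
        by (simp only: powr_add[symmetric]) simp
      finally show "norm (norm Q powr (p - 4) * ((A *v Q) \<bullet> Q)) \<le> K * norm Q powr (p - 2)"
        by (simp add: abs_mult)
    qed
    show "((\<lambda>Q::real ^ ('m option). K * norm Q powr (p - 2)) \<longlongrightarrow> 0) (at 0)"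
      using tendsto_mult_right_zero[OF pw] .
  qed
  have "((\<lambda>Q. norm Q powr (p - 2) * trace A
     + (p - 2) * (norm Q powr (p - 4) * ((A *v Q) \<bullet> Q))
     + (real CARD('m option) - p) * norm Q powr (p - 2) * (Q $ None)) \<longlongrightarrow>
     0 * trace A + (p - 2) * 0 + (real CARD('m option) - p) * 0 * ((0::real ^ ('m option)) $ None)) (at 0)"
    by (intro tendsto_intros pw mid)
  then show ?thesis using False by (simp add: pLap_nz_def mult.assoc)
qed

lemma pLap_0:
  fixes A :: "real ^ ('m::finite option) ^ ('m option)"
  assumes "p \<ge> 2"
  shows "pLap p 0 A = (if p = 2 then trace A else 0)"
  unfolding pLap_def using tendsto_Lim[OF _ tendsto_pLap_nz_0[OF assms, of A]] by simp

definition F_op ::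
  "real \<Rightarrow> (real \<times> (real ^ 'm::finite) \<Rightarrow> real) \<Rightarrow> real \<times> (real ^ 'm) \<Rightarrow>
   real ^ ('m option) \<Rightarrow> real ^ ('m option) ^ ('m option) \<Rightarrow> real" where
  "F_op p f z P A = fst z powr (- p) * pLap p P A - f z"

definition viscosity_subsolution ::
  "(real ^ 'm::finite) set \<Rightarrow> real \<Rightarrow> (real \<times> (real ^ 'm) \<Rightarrow> real) \<Rightarrow> (real \<times> (real ^ 'm) \<Rightarrow> real) \<Rightarrow> bool" where
  "viscosity_subsolution X p f w \<longleftrightarrow> usc_on (cone_dom X) w \<and>
     (\<forall>\<phi> z0. Ck_on 2 (cone_dom X) \<phi> \<and> z0 \<in> cone_dom X \<and>
        (\<forall>\<^sub>F z in at z0 within cone_dom X. w z - \<phi> z \<le> w z0 - \<phi> z0) \<longrightarrow>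
        F_op p f z0 (grad_B \<phi> z0) (hess_B \<phi> z0) \<ge> 0)"

definition viscosity_supersolution ::
  "(real ^ 'm::finite) set \<Rightarrow> real \<Rightarrow> (real \<times> (real ^ 'm) \<Rightarrow> real) \<Rightarrow> (real \<times> (real ^ 'm) \<Rightarrow> real) \<Rightarrow> bool" where
  "viscosity_supersolution X p f w \<longleftrightarrow> lsc_on (cone_dom X) w \<and>
     (\<forall>\<phi> z0. Ck_on 2 (cone_dom X) \<phi> \<and> z0 \<in> cone_dom X \<and>
        (\<forall>\<^sub>F z in at z0 within cone_dom X. w z - \<phi> z \<ge> w z0 - \<phi> z0) \<longrightarrow>
        F_op p f z0 (grad_B \<phi> z0) (hess_B \<phi> z0) \<le> 0)"

end

theory Submission
  imports Defs "HOL-Library.Function_Algebras"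
begin

text \<open>
  In the coordinate \<open>s = ln t\<close> the operators \<open>t \<partial>\<^sub>t, \<partial>\<^sub>x\<^sub>i\<close> become ordinary derivatives and the
  equation reads \<open>F(\<nabla>w, D\<^sup>2w) = g\<close> with \<open>g = t\<^sup>p f \<ge> \<omega>\<close> and \<open>F\<close> homogeneous of degree \<open>p - 1\<close>, so
  \<open>(1 + \<eta>) u\<close> is a strict subsolution. If \<open>(1 + \<eta>) u - v\<close> had a large interior maximum, the sup-convolution
  \<open>U\<close> of \<open>(1 + \<eta>) u\<close> and the inf-convolution \<open>V\<close> of \<open>v\<close> would have a maximum of \<open>U - V\<close> at some \<open>z0\<close>,
  with a common gradient \<open>P0\<close> there; \<open>P0\<close> is not degenerate because \<open>g > 0\<close>. A test function touching
  \<open>U\<close> from above near \<open>z0\<close> has its gradient close to \<open>P0\<close> and its Hessian bounded below, which makes \<open>U\<close> a viscosity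
  subsolution of a uniformly elliptic equation with constant coefficients frozen at \<open>P0\<close>; likewise for
  \<open>V\<close>. For such a linear operator \<open>L\<close> no twice differentiability theorem is needed: a polynomial \<open>h\<close>
  with \<open>L h\<close> constant and boundary values close to \<open>U\<close> on a small sphere separates \<open>U\<close> from \<open>V\<close>,
  contradicting the maximum.
\<close>

section \<open>Directional derivatives of polynomials\<close>

abbreviation rpoly :: "('a::real_normed_vector \<Rightarrow> real) \<Rightarrow> bool" where
  "rpoly \<equiv> real_polynomial_function"

lemmas rpoly_linear = real_polynomial_function.intros(1)
  and rpoly_const = real_polynomial_function.intros(2)
  and rpoly_add = real_polynomial_function.intros(3)
  and rpoly_mult = real_polynomial_function.intros(4)

definition dir_deriv :: "'a::real_normed_vector \<Rightarrow> ('a \<Rightarrow> real) \<Rightarrow> 'a \<Rightarrow> real" where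
  "dir_deriv v q x = frechet_derivative q (at x) v"

lemma rpoly_has_derivative:
  "rpoly q \<Longrightarrow> (q has_derivative (\<lambda>v. dir_deriv v q x)) (at x)"
  using differentiable_at_real_polynomial_function[of q x UNIV]
  by (simp add: dir_deriv_def frechet_derivative_works)

lemma dir_deriv_eqI: "(q has_derivative D) (at x) \<Longrightarrow> dir_deriv v q x = D v"
  unfolding dir_deriv_def using frechet_derivative_at by metis

lemma dir_deriv_const [simp]: "dir_deriv v (\<lambda>_. c) = (\<lambda>_. 0)"
  by (rule ext, rule dir_deriv_eqI[where D = "\<lambda>_. 0"]) simp

lemma dir_deriv_bounded_linear: "bounded_linear f \<Longrightarrow> dir_deriv v f = (\<lambda>_. f v)"
  by (rule ext, rule dir_deriv_eqI) (rule bounded_linear_imp_has_derivative)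

lemma dir_deriv_add:
  "rpoly q \<Longrightarrow> rpoly r \<Longrightarrow> dir_deriv v (\<lambda>x. q x + r x) = (\<lambda>x. dir_deriv v q x + dir_deriv v r x)"
  by (rule ext, rule dir_deriv_eqI) (intro has_derivative_add rpoly_has_derivative)

lemma dir_deriv_diff:
  "rpoly q \<Longrightarrow> rpoly r \<Longrightarrow> dir_deriv v (\<lambda>x. q x - r x) = (\<lambda>x. dir_deriv v q x - dir_deriv v r x)"
  by (rule ext, rule dir_deriv_eqI) (intro has_derivative_diff rpoly_has_derivative)

lemma dir_deriv_mult:
  assumes "rpoly q" "rpoly r"
  shows "dir_deriv v (\<lambda>x. q x * r x) = (\<lambda>x. q x * dir_deriv v r x + dir_deriv v q x * r x)"
  by (rule ext, rule dir_deriv_eqI)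
     (use has_derivative_mult[OF rpoly_has_derivative rpoly_has_derivative] assms in blast)

lemma dir_deriv_cmult:
  "rpoly q \<Longrightarrow> dir_deriv v (\<lambda>x. c * q x) = (\<lambda>x. c * dir_deriv v q x)"
  using dir_deriv_mult[of "\<lambda>_. c" q v] by (simp add: rpoly_const)

lemma rpoly_dir_deriv [intro]: "rpoly q \<Longrightarrow> rpoly (dir_deriv v q)"
proof (induction q rule: real_polynomial_function.induct)
  case (mult f g)
  then show ?case by (auto simp: dir_deriv_mult)
qed (auto simp: dir_deriv_bounded_linear dir_deriv_add)

lemma dir_deriv_linear: "rpoly q \<Longrightarrow> linear (\<lambda>v. dir_deriv v q x)"
  using rpoly_has_derivative has_derivative_linear by blast

lemma dir_deriv_add_dir:
  "rpoly q \<Longrightarrow> dir_deriv (v + w) q = (\<lambda>x. dir_deriv v q x + dir_deriv w q x)"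
  by (rule ext) (rule linear_add[OF dir_deriv_linear])

lemma dir_deriv_scale_dir:
  "rpoly q \<Longrightarrow> dir_deriv (c *\<^sub>R v) q = (\<lambda>x. c * dir_deriv v q x)"
  using linear_scale[OF dir_deriv_linear[of q]] by (intro ext) simp

text \<open>For polynomials the symmetry of second derivatives is purely algebraic: it is trivial
  for linear functions and constants, and the Leibniz rule applied twice is symmetric in the two
  directions.\<close>

lemma dir_deriv_commute:
  "rpoly q \<Longrightarrow> dir_deriv v (dir_deriv w q) = dir_deriv w (dir_deriv v q)"
proof (induction q rule: real_polynomial_function.induct)
  case (add f g)
  then show ?case by (simp add: dir_deriv_add rpoly_dir_deriv)
next
  case (mult f g)
  then show ?case
    by (simp add: dir_deriv_mult dir_deriv_add rpoly_dir_deriv rpoly_mult fun_eq_iff algebra_simps)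
qed (simp_all add: dir_deriv_bounded_linear)

lemma rpoly_affine:
  assumes "rpoly q" shows "rpoly (\<lambda>x. q (x + a))"
proof -
  have "rpoly (q \<circ> (\<lambda>x. x + a))"
    by (intro real_polynomial_function_compose assms polynomial_function_add) auto
  then show ?thesis by (simp add: o_def)
qed

lemma dir_deriv_translate:
  assumes "rpoly q" shows "dir_deriv v (\<lambda>x. q (x + a)) = (\<lambda>x. dir_deriv v q (x + a))"
proof (rule ext, rule dir_deriv_eqI)
  fix x
  have "((\<lambda>x. x + a) has_derivative (\<lambda>v. v)) (at x)"
    by (auto intro!: derivative_eq_intros)
  from has_derivative_compose[OF this rpoly_has_derivative[OF assms]]
  show "((\<lambda>x. q (x + a)) has_derivative (\<lambda>v. dir_deriv v q (x + a))) (at x)" .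
qed

lemma rpoly_sqdist: "rpoly (\<lambda>x::'a::euclidean_space. (norm (x - a))\<^sup>2)"
proof -
  have "(\<lambda>x. (norm (x - a))\<^sup>2) = (\<lambda>x. (x \<bullet> x + (-2) * (a \<bullet> x)) + a \<bullet> a)"
    by (simp add: power2_norm_eq_inner inner_diff inner_commute fun_eq_iff)
  moreover have "rpoly (\<lambda>x::'a. x \<bullet> x)"
  proof -
    have "rpoly (\<lambda>x::'a. \<Sum>b\<in>Basis. (x \<bullet> b) * (x \<bullet> b))"
      by (intro real_polynomial_function_sum rpoly_mult rpoly_linear)
         (auto intro: bounded_linear_inner_left)
    then show ?thesis by (simp flip: euclidean_inner)
  qed
  moreover have "rpoly (\<lambda>x::'a. a \<bullet> x)"
    by (intro rpoly_linear bounded_linear_inner_right)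
  ultimately show ?thesis
    by (auto simp only: intro!: rpoly_add rpoly_mult rpoly_const)
qed

lemma dir_deriv_sqdist:
  "dir_deriv v (\<lambda>x::'a::euclidean_space. (norm (x - a))\<^sup>2) = (\<lambda>x. 2 * ((x - a) \<bullet> v))"
proof (rule ext, rule dir_deriv_eqI)
  fix x :: 'a
  show "((\<lambda>x. (norm (x - a))\<^sup>2) has_derivative (\<lambda>v. 2 * ((x - a) \<bullet> v))) (at x)"
    unfolding power2_norm_eq_inner by (auto intro!: derivative_eq_intros simp: inner_commute)
qed

lemma dir_deriv2_sqdist:
  "dir_deriv w (dir_deriv v (\<lambda>x::'a::euclidean_space. (norm (x - a))\<^sup>2)) = (\<lambda>_. 2 * (w \<bullet> v))"
  unfolding dir_deriv_sqdist
  by (rule ext, rule dir_deriv_eqI) (auto intro!: derivative_eq_intros)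

section \<open>Restriction of polynomials to lines, and conditions at a local maximum\<close>

lemma rpoly_line_has_real_derivative:
  assumes "rpoly q"
  shows "((\<lambda>t. q (z + t *\<^sub>R v)) has_real_derivative dir_deriv v q (z + t *\<^sub>R v)) (at t)"
proof -
  have "((\<lambda>t. z + t *\<^sub>R v) has_derivative (\<lambda>h. h *\<^sub>R v)) (at t)"
    by (auto intro!: derivative_eq_intros)
  from has_derivative_compose[OF this rpoly_has_derivative[OF assms]]
  have "((\<lambda>t. q (z + t *\<^sub>R v)) has_derivative (\<lambda>h. dir_deriv (h *\<^sub>R v) q (z + t *\<^sub>R v))) (at t)" .
  then show ?thesis
    by (simp add: has_field_derivative_def dir_deriv_scale_dir[OF assms] mult_commute_abs)
qed

lemma eventually_nhds_line:
  assumes "\<forall>\<^sub>F y in nhds z. P y" shows "\<forall>\<^sub>F t::real in nhds 0. P (z + t *\<^sub>R (v::'a::real_normed_vector))"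
proof -
  have "((\<lambda>t::real. z + t *\<^sub>R v) \<longlongrightarrow> z + 0 *\<^sub>R v) (nhds 0)"
    by (intro tendsto_intros filterlim_ident)
  then show ?thesis using assms by (simp add: filterlim_iff)
qed

text \<open>Both conditions are one-dimensional, along the line \<open>z + t *\<^sub>R v\<close>. A
  positive second derivative would make the first derivative positive just to the right of 0, and
  the mean value theorem would then give a value above the maximum.\<close>

lemma rpoly_local_max:
  assumes q: "rpoly q" and max: "\<forall>\<^sub>F y in nhds z. q y \<le> q z"
  shows "dir_deriv v q z = 0" "dir_deriv v (dir_deriv v q) z \<le> 0"
proof -
  let ?h = "\<lambda>t. q (z + t *\<^sub>R v)" and ?h' = "\<lambda>t. dir_deriv v q (z + t *\<^sub>R v)"
  have D: "(?h has_real_derivative ?h' t) (at t)" for t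
    by (rule rpoly_line_has_real_derivative[OF q])
  have D': "(?h' has_real_derivative dir_deriv v (dir_deriv v q) z) (at 0)"
    using rpoly_line_has_real_derivative[OF rpoly_dir_deriv[OF q], where t = 0] by simp
  obtain e where e: "e > 0" "\<And>t. \<bar>t\<bar> < e \<Longrightarrow> ?h t \<le> ?h 0"
    using eventually_nhds_line[OF max, of v] unfolding eventually_nhds_metric by (auto simp: dist_real_def)
  show zero: "dir_deriv v q z = 0"
    using DERIV_local_max[OF D[of 0] e(1)] e(2) by simp
  show "dir_deriv v (dir_deriv v q) z \<le> 0"
  proof (rule ccontr)
    assume "\<not> ?thesis"
    then obtain d where d: "d > 0" "\<And>t. 0 < t \<Longrightarrow> t < d \<Longrightarrow> ?h' 0 < ?h' (0 + t)"
      using DERIV_pos_inc_right[OF D'] by auto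
    define s where "s = min d e / 2"
    have s: "0 < s" "s < d" "s < e" using d e by (auto simp: s_def)
    obtain t where t: "0 < t" "t < s" "?h s - ?h 0 = (s - 0) * ?h' t"
      using MVT2[of 0 s ?h ?h'] s D by auto
    have "?h' t > 0" using d(2)[of t] t s zero by simp
    then have "?h s > ?h 0" using t s by (smt (verit) mult_pos_pos)
    moreover have "?h s \<le> ?h 0" using e(2)[of s] s by simp
    ultimately show False by simp
  qed
qed

lemma rpoly_local_max_diff:
  assumes q: "rpoly q" and r: "rpoly r" and max: "\<forall>\<^sub>F y in nhds z. q y - r y \<le> q z - r z"
  shows "dir_deriv v q z = dir_deriv v r z"
    and "dir_deriv v (dir_deriv v q) z \<le> dir_deriv v (dir_deriv v r) z"
  using rpoly_local_max[where q = "\<lambda>y. q y - r y" and z = z and v = v] max q r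
  by (auto simp: dir_deriv_diff rpoly_dir_deriv)

text \<open>On the line from \<open>z\<close> through \<open>x\<close> the function becomes a
  polynomial in one variable with infinitely many roots, so it vanishes identically, in particular
  at parameter 1.\<close>

lemma rpoly_eq_0_if_eq_0_on_ball:
  fixes q :: "'a::real_normed_vector \<Rightarrow> real"
  assumes q: "rpoly q" and r: "r > 0" and 0: "\<And>x. x \<in> ball z r \<Longrightarrow> q x = 0"
  shows "q x = 0"
proof (cases "x = z")
  case False
  have "rpoly (q \<circ> (\<lambda>t::real. z + t *\<^sub>R (x - z)))"
  proof (rule real_polynomial_function_compose[OF _ q])
    have "polynomial_function (\<lambda>t::real. t *\<^sub>R (x - z))"
      by (intro polynomial_function_bounded_linear bounded_linear_scaleR_left)
    then show "polynomial_function (\<lambda>t::real. z + t *\<^sub>R (x - z))"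
      by (intro polynomial_function_add) auto
  qed
  then obtain a n where an: "\<And>t. q (z + t *\<^sub>R (x - z)) = (\<Sum>i\<le>n. a i * t ^ i)"
    using real_polynomial_function_imp_sum[of "q \<circ> (\<lambda>t::real. z + t *\<^sub>R (x - z))"]
    by (auto simp: o_def fun_eq_iff)
  define e where "e = r / norm (x - z)"
  have e: "e > 0" using False r by (simp add: e_def)
  have "{0<..<e} \<subseteq> {t. (\<Sum>i\<le>n. a i * t ^ i) = 0}"
  proof clarsimp
    fix t assume t: "0 < t" "t < e"
    have "dist z (z + t *\<^sub>R (x - z)) = t * norm (x - z)"
      using t by (simp add: dist_norm)
    then have "z + t *\<^sub>R (x - z) \<in> ball z r"
      using False t by (simp add: e_def pos_less_divide_eq)
    then show "(\<Sum>i\<le>n. a i * t ^ i) = 0" using 0 an by metis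
  qed
  moreover have "infinite {0<..<e}" using e by (simp add: infinite_Ioo)
  ultimately have "\<forall>i\<le>n. a i = 0"
    using polyfun_finite_roots[of a n] finite_subset by blast
  then have "q (z + 1 *\<^sub>R (x - z)) = 0" unfolding an by simp
  then show ?thesis by simp
qed (use 0 r in simp)

section \<open>Polynomials of bounded degree\<close>

text \<open>This is the dimension count for an injective endomorphism. A value \<open>y\<close>
  outside the image would extend the independent image of a basis to an independent subset of the
  span with too many elements.\<close>

lemma (in vector_space) inj_imp_surj_on_finite_span:
  assumes S: "finite S"
    and maps: "\<And>x. x \<in> span S \<Longrightarrow> T x \<in> span S"
    and add: "\<And>x y. x \<in> span S \<Longrightarrow> y \<in> span S \<Longrightarrow> T (x + y) = T x + T y"
    and scale: "\<And>c x. x \<in> span S \<Longrightarrow> T (scale c x) = scale c (T x)"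
    and inj: "\<And>x. x \<in> span S \<Longrightarrow> T x = 0 \<Longrightarrow> x = 0"
    and y: "y \<in> span S"
  shows "\<exists>x\<in>span S. T x = y"
proof -
  interpret vector_space_pair scale scale ..
  obtain B where B: "B \<subseteq> S" "independent B" "S \<subseteq> span B"
    using maximal_independent_subset[of S] by blast
  have fB: "finite B" using B S finite_subset by blast
  have spB: "span B = span S"
    using B by (metis span_mono span_span subset_antisym)
  \<comment> \<open>\<open>T\<close> is additive and homogeneous only on the span, whereas
    \<open>Vector_Spaces.linear\<close> speaks of the whole space. \<open>T'\<close> is a globally
    linear map that agrees with \<open>T\<close> on the span.\<close>
  define T' where "T' = construct B T"
  have lin: "Vector_Spaces.linear scale scale T'" unfolding T'_def by (rule linear_construct[OF B(2)])
  interpret T': Vector_Spaces.linear scale scale T' by (rule lin)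
  have T'_aux: "x \<in> span S \<and> T' x = T x" if "x \<in> span B" for x
    using that
  proof (induction rule: span_induct_alt)
    case base
    show ?case using scale[of 0 0] T'.zero by (simp add: span_zero)
  next
    case (step c b y)
    have "T' b = T b" unfolding T'_def by (rule construct_basis[OF B(2) step(1)])
    moreover have "b \<in> span S" using step B span_base by blast
    ultimately show ?case
      using step(2) by (simp add: T'.add T'.scale add[OF span_scale] scale span_add span_scale)
  qed
  then have T': "T' x = T x" if "x \<in> span B" for x using that by blast
  have inj': "inj_on T' (span B)"
    unfolding T'.inj_on_iff_eq_0[OF subspace_span] using T' inj spB by auto
  have ind: "independent (T' ` B)" by (rule T'.independent_injective_image[OF B(2) inj'])
  have card: "card (T' ` B) = card B"
    using inj' by (intro card_image) (meson inj_on_subset span_superset)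
  have "y \<in> span (T' ` B)"
  proof (rule ccontr)
    assume nin: "y \<notin> span (T' ` B)"
    then have "independent (insert y (T' ` B))" using ind by (simp add: independent_insert)
    moreover have "insert y (T' ` B) \<subseteq> span B"
      using y spB T' maps span_superset[of B] by (auto simp: subset_iff)
    ultimately have "card (insert y (T' ` B)) \<le> card B"
      using independent_span_bound[OF fB] by blast
    moreover have "y \<notin> T' ` B" using nin span_superset by blast
    ultimately show False using card fB by simp
  qed
  then obtain x where "x \<in> span B" "T' x = y" by (auto simp: T'.span_image)
  then show ?thesis using T' spB by auto
qed

text \<open>Zero and sum are the pointwise ones from \<open>Function_Algebras\<close>, which is why
  \<open>zero_fun_def\<close> and \<open>plus_fun_def\<close> mediate between spans and lambda terms
  below.\<close>

interpretation fun_vs: vector_space "\<lambda>(c::real) (f::'a \<Rightarrow> real) x. c * f x"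
  by standard (auto simp: fun_eq_iff algebra_simps)

section \<open>The finite-dimensional spaces of polynomials of degree at most
  \<open>d\<close>\<close>

primrec monomials :: "nat \<Rightarrow> ('a::euclidean_space \<Rightarrow> real) set" where
  "monomials 0 = {\<lambda>_. 1}"
| "monomials (Suc d) = monomials d \<union> (\<Union>b\<in>Basis. (\<lambda>s x. (x \<bullet> b) * s x) ` monomials d)"

text \<open>The degree bound is encoded as membership in a span of finitely many coordinate
  products, so that the dimension count above applies. Only an upper bound on the degree is ever
  needed, never the exact degree.\<close>

definition rpoly_le :: "nat \<Rightarrow> ('a::euclidean_space \<Rightarrow> real) set" where
  "rpoly_le d = fun_vs.span (monomials d)"

lemma finite_monomials: "finite (monomials d)"
  by (induction d) auto

lemma rpoly_monomial: "s \<in> monomials d \<Longrightarrow> rpoly s"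
proof (induction d arbitrary: s)
  case (Suc d)
  have "rpoly (\<lambda>x. x \<bullet> b)" for b :: 'a
    by (intro rpoly_linear bounded_linear_inner_left)
  then show ?case using Suc by (auto intro: rpoly_mult)
qed (simp add: rpoly_const)

lemma rpoly_le_base: "s \<in> monomials d \<Longrightarrow> s \<in> rpoly_le d"
  unfolding rpoly_le_def by (rule fun_vs.span_base)

lemma rpoly_le_add: "f \<in> rpoly_le d \<Longrightarrow> g \<in> rpoly_le d \<Longrightarrow> (\<lambda>x. f x + g x) \<in> rpoly_le d"
  unfolding rpoly_le_def using fun_vs.span_add[of f _ g] by (simp add: plus_fun_def)

lemma rpoly_le_cmult: "f \<in> rpoly_le d \<Longrightarrow> (\<lambda>x. c * f x) \<in> rpoly_le d"
  unfolding rpoly_le_def by (rule fun_vs.span_scale)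

lemma rpoly_le_diff: "f \<in> rpoly_le d \<Longrightarrow> g \<in> rpoly_le d \<Longrightarrow> (\<lambda>x. f x - g x) \<in> rpoly_le d"
  using rpoly_le_add[of f d "\<lambda>x. -1 * g x"] rpoly_le_cmult[of g d "-1"] by simp

lemma rpoly_le_zero: "(\<lambda>_. 0) \<in> rpoly_le d"
  unfolding rpoly_le_def using fun_vs.span_zero by (simp add: zero_fun_def)

lemma rpoly_le_sum:
  "(\<And>i. i \<in> I \<Longrightarrow> f i \<in> rpoly_le d) \<Longrightarrow> (\<lambda>x. \<Sum>i\<in>I. f i x) \<in> rpoly_le d"
proof (induction I rule: infinite_finite_induct)
  case (insert i I)
  then have "(\<lambda>x. f i x + (\<Sum>i\<in>I. f i x)) \<in> rpoly_le d" by (intro rpoly_le_add) simp_all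
  then show ?case using insert by simp
qed (simp_all add: rpoly_le_zero)

lemma monomials_mono: "d \<le> e \<Longrightarrow> monomials d \<subseteq> monomials e"
  by (induction e rule: nat_induct) (auto simp: le_Suc_eq)

lemma rpoly_le_mono: "d \<le> e \<Longrightarrow> f \<in> rpoly_le d \<Longrightarrow> f \<in> rpoly_le e"
  unfolding rpoly_le_def using fun_vs.span_mono monomials_mono by blast

lemma rpoly_le_induct [consumes 1, case_names zero step]:
  assumes "f \<in> rpoly_le d" "P (\<lambda>_. 0)"
    "\<And>c s g. s \<in> monomials d \<Longrightarrow> g \<in> rpoly_le d \<Longrightarrow> P g \<Longrightarrow> P (\<lambda>x. c * s x + g x)"
  shows "P f"
proof -
  have "f \<in> rpoly_le d \<and> P f"
    using assms(1) unfolding rpoly_le_def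
  proof (induction rule: fun_vs.span_induct_alt)
    case base
    then show ?case using assms(2) fun_vs.span_zero by (simp add: zero_fun_def)
  next
    case (step c x y)
    then show ?case using assms(3)[of x y c] rpoly_le_add[OF rpoly_le_cmult[OF rpoly_le_base]]
      by (auto simp: plus_fun_def rpoly_le_def)
  qed
  then show ?thesis ..
qed

lemma rpoly_if_rpoly_le: "f \<in> rpoly_le d \<Longrightarrow> rpoly f"
proof (induction rule: rpoly_le_induct)
  case (step c s g)
  then show ?case using rpoly_monomial[OF step(1)] by (intro rpoly_add rpoly_mult rpoly_const)
qed (rule rpoly_const)

lemma rpoly_le_const: "(\<lambda>_. c) \<in> rpoly_le d"
  using rpoly_le_mono[of 0 d] rpoly_le_cmult[OF rpoly_le_base[of "\<lambda>_. 1" 0], of c] by simp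

lemma rpoly_le_coord_mult:
  assumes "f \<in> rpoly_le d" "b \<in> Basis"
  shows "(\<lambda>x. (x \<bullet> b) * f x) \<in> rpoly_le (Suc d)"
  using assms(1)
proof (induction rule: rpoly_le_induct)
  case zero
  then show ?case by (simp add: rpoly_le_zero)
next
  case (step c s g)
  have "(\<lambda>x. (x \<bullet> b) * s x) \<in> rpoly_le (Suc d)"
    using step assms(2) by (intro rpoly_le_base) auto
  from rpoly_le_add[OF rpoly_le_cmult[OF this, of c] step(3)]
  show ?case by (simp add: algebra_simps)
qed

lemma rpoly_le_monomial_mult:
  "s \<in> monomials d \<Longrightarrow> f \<in> rpoly_le e \<Longrightarrow> (\<lambda>x. s x * f x) \<in> rpoly_le (d + e)"
proof (induction d arbitrary: s)
  case (Suc d)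
  then consider "s \<in> monomials d" | b r where "b \<in> Basis" "r \<in> monomials d" "s = (\<lambda>x. (x \<bullet> b) * r x)"
    by auto
  then show ?case
  proof cases
    case 1
    have "(\<lambda>x. s x * f x) \<in> rpoly_le (d + e)" using Suc 1 by blast
    then show ?thesis by (rule rpoly_le_mono[rotated]) simp
  next
    case 2
    then show ?thesis
      using rpoly_le_coord_mult[OF Suc.IH[OF 2(2)] 2(1)] Suc.prems by (simp add: mult.assoc)
  qed
qed auto

lemma rpoly_le_mult:
  assumes "f \<in> rpoly_le d" "g \<in> rpoly_le e"
  shows "(\<lambda>x. f x * g x) \<in> rpoly_le (d + e)"
  using assms(1)
proof (induction rule: rpoly_le_induct)
  case zero
  then show ?case by (simp add: rpoly_le_zero)
next
  case (step c s h)
  from rpoly_le_add[OF rpoly_le_cmult[OF rpoly_le_monomial_mult[OF step(1) assms(2)], of c] step(3)]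
  show ?case by (simp add: algebra_simps)
qed

lemma rpoly_le_linear:
  assumes "bounded_linear f" shows "f \<in> rpoly_le (Suc 0)"
proof -
  interpret bounded_linear f by fact
  have "f = (\<lambda>x. \<Sum>b\<in>Basis. f b * ((x \<bullet> b) * 1))"
  proof
    fix x
    have "f x = f (\<Sum>b\<in>Basis. (x \<bullet> b) *\<^sub>R b)" by (simp add: euclidean_representation)
    then show "f x = (\<Sum>b\<in>Basis. f b * ((x \<bullet> b) * 1))" by (simp add: sum scale mult.commute)
  qed
  also have "(\<lambda>x. \<Sum>b\<in>Basis. f b * ((x \<bullet> b) * 1)) \<in> rpoly_le (Suc 0)"
    by (rule rpoly_le_sum, rule rpoly_le_cmult, rule rpoly_le_base) auto
  finally show ?thesis .
qed

lemma rpoly_imp_rpoly_le: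
  assumes "rpoly f" shows "\<exists>d. f \<in> rpoly_le d"
  using assms
proof (induction f rule: real_polynomial_function.induct)
  case (add f g)
  then obtain d e where "f \<in> rpoly_le d" "g \<in> rpoly_le e" by auto
  then have "(\<lambda>x. f x + g x) \<in> rpoly_le (max d e)"
    using rpoly_le_mono[of d "max d e" f] rpoly_le_mono[of e "max d e" g] by (simp add: rpoly_le_add)
  then show ?case ..
next
  case (mult f g)
  then show ?case using rpoly_le_mult by blast
next
  case (linear f)
  then show ?case using rpoly_le_linear by blast
next
  case (const c)
  show ?case using rpoly_le_const by blast
qed

text \<open>For \<open>d = 0\<close> the truncated subtraction leaves degree 0, which is correct
  because the derivative of a constant is zero.\<close>

lemma rpoly_le_dir_deriv:
  assumes "f \<in> rpoly_le d" shows "dir_deriv v f \<in> rpoly_le (d - 1)"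
  using assms
proof (induction rule: rpoly_le_induct)
  case (step c s g)
  have "dir_deriv v s \<in> rpoly_le (d - 1)"
    using step(1)
  proof (induction d arbitrary: s)
    case (Suc d)
    then consider "s \<in> monomials d" | b r where "b \<in> Basis" "r \<in> monomials d" "s = (\<lambda>x. (x \<bullet> b) * r x)"
      by auto
    then show ?case
    proof cases
      case 1
      then show ?thesis using Suc.IH[OF 1] rpoly_le_mono[of "d - 1" d] by simp
    next
      case 2
      have bl: "bounded_linear (\<lambda>x. x \<bullet> b)" by (rule bounded_linear_inner_left)
      have "dir_deriv v s = (\<lambda>x. (x \<bullet> b) * dir_deriv v r x + (v \<bullet> b) * r x)"
        unfolding 2(3) using rpoly_monomial[OF 2(2)] rpoly_linear[OF bl]
        by (simp add: dir_deriv_mult dir_deriv_bounded_linear[OF bl])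
      moreover have "(\<lambda>x. (x \<bullet> b) * dir_deriv v r x) \<in> rpoly_le d"
      \<comment> \<open>Multiplying by a coordinate raises the degree of
        \<open>dir_deriv v r\<close> from \<open>d - 1\<close> back to \<open>d\<close> only when
        \<open>d\<close> is positive. For \<open>d = 0\<close> the factor \<open>r\<close> is
        constant and the term vanishes.\<close>
      proof (cases d)
        case 0
        then show ?thesis using 2(2) by (simp add: rpoly_le_zero)
      next
        case (Suc d')
        then show ?thesis
          using rpoly_le_coord_mult[OF Suc.IH[OF 2(2)] 2(1)] by simp
      qed
      moreover have "(\<lambda>x. (v \<bullet> b) * r x) \<in> rpoly_le d"
        by (rule rpoly_le_cmult, rule rpoly_le_base, rule 2)
      ultimately show ?thesis by (simp add: rpoly_le_add)
    qed
  qed (simp add: rpoly_le_zero)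
  from rpoly_le_add[OF rpoly_le_cmult[OF this, of c] step(3)] show ?case
    using rpoly_monomial[OF step(1)] rpoly_if_rpoly_le[OF step(2)]
    by (simp add: dir_deriv_add dir_deriv_cmult rpoly_mult rpoly_const)
qed (simp add: rpoly_le_zero)

section \<open>Constant-coefficient operators\<close>

definition laplacian :: "('a::euclidean_space \<Rightarrow> real) \<Rightarrow> 'a \<Rightarrow> real" where
  "laplacian q z = (\<Sum>b\<in>Basis. dir_deriv b (dir_deriv b q) z)"

text \<open>With the gradient frozen, the second-order part of the \<open>p\<close>-Laplacian is a
  multiple of the Laplacian plus one second derivative in a fixed direction; \<open>d\<close>
  carries the square root of its weight. The operator is elliptic for \<open>a > 0\<close>.\<close>

definition lin_op :: "real \<Rightarrow> 'a::euclidean_space \<Rightarrow> ('a \<Rightarrow> real) \<Rightarrow> 'a \<Rightarrow> real" where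
  "lin_op a d q z = a * laplacian q z + dir_deriv d (dir_deriv d q) z"

lemma lin_op_add:
  "rpoly q \<Longrightarrow> rpoly r \<Longrightarrow> lin_op a d (\<lambda>x. q x + r x) z = lin_op a d q z + lin_op a d r z"
  by (simp add: lin_op_def laplacian_def dir_deriv_add rpoly_dir_deriv sum.distrib algebra_simps)

lemma lin_op_cmult:
  "rpoly q \<Longrightarrow> lin_op a d (\<lambda>x. c * q x) z = c * lin_op a d q z"
  by (simp add: lin_op_def laplacian_def dir_deriv_cmult rpoly_dir_deriv sum_distrib_left algebra_simps)

lemma lin_op_uminus: "rpoly q \<Longrightarrow> lin_op a d (\<lambda>x. - q x) z = - lin_op a d q z"
  using lin_op_cmult[of q a d "-1" z] by simp

lemma lin_op_diff:
  "rpoly q \<Longrightarrow> rpoly r \<Longrightarrow> lin_op a d (\<lambda>x. q x - r x) z = lin_op a d q z - lin_op a d r z"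
  using lin_op_add[of q "\<lambda>x. - r x" a d z] by (simp add: lin_op_uminus real_polynomial_function_minus)

lemma laplacian_sqdist: "laplacian (\<lambda>x::'a::euclidean_space. (norm (x - y))\<^sup>2) z = 2 * DIM('a)"
  by (simp add: laplacian_def dir_deriv2_sqdist inner_Basis)

lemma lin_op_sqdist:
  "lin_op a d (\<lambda>x::'a::euclidean_space. (norm (x - y))\<^sup>2) z = 2 * (a * DIM('a) + d \<bullet> d)"
  by (simp add: lin_op_def laplacian_sqdist dir_deriv2_sqdist algebra_simps)

lemma lin_op_local_max:
  assumes "rpoly q" "rpoly r" "\<forall>\<^sub>F y in nhds z. q y - r y \<le> q z - r z" "a \<ge> 0"
  shows "lin_op a d q z \<le> lin_op a d r z"
  unfolding lin_op_def laplacian_def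
  by (intro add_mono mult_left_mono sum_mono rpoly_local_max_diff assms)

lemma rpoly_le_lin_op:
  assumes "q \<in> rpoly_le (Suc (Suc n))" shows "lin_op a d q \<in> rpoly_le n"
proof -
  have D: "dir_deriv v (dir_deriv v q) \<in> rpoly_le n" for v
    using rpoly_le_dir_deriv[OF rpoly_le_dir_deriv[OF assms, of v], of v] by simp
  have "laplacian q \<in> rpoly_le n"
    unfolding laplacian_def[abs_def] by (rule rpoly_le_sum[OF D])
  from rpoly_le_add[OF rpoly_le_cmult[OF this] D] show ?thesis
    unfolding lin_op_def[abs_def] .
qed

section \<open>Constant-coefficient equations on a ball: comparison and the Dirichlet
  problem\<close>

definition lin_subsol ::
  "real \<Rightarrow> 'a::euclidean_space \<Rightarrow> real \<Rightarrow> 'a set \<Rightarrow> ('a \<Rightarrow> real) \<Rightarrow> bool" where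
  "lin_subsol a d c N w \<longleftrightarrow> (\<forall>q z. rpoly q \<and> z \<in> N \<and> (\<forall>\<^sub>F y in nhds z. w y - q y \<le> w z - q z) \<longrightarrow>
     c \<le> lin_op a d q z)"

text \<open>The function \<open>h\<close> is itself an admissible test function. An interior maximum
  of \<open>w - h\<close> would force \<open>c\<close> to be at most \<open>lin_op a d h\<close>, so
  the maximum lies on the sphere.\<close>

lemma lin_subsol_comparison:
  assumes cont: "continuous_on (cball z r) w" and sub: "lin_subsol a d c (ball z r) w"
    and h: "rpoly h" "\<And>x. lin_op a d h x < c"
    and bd: "\<And>x. x \<in> sphere z r \<Longrightarrow> w x \<le> h x + s"
    and x: "x \<in> cball z r"
  shows "w x \<le> h x + s"
proof -
  have "continuous_on (cball z r) (\<lambda>x. w x - h x)"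
    by (intro continuous_on_diff cont continuous_on_polymonial_function)
       (use h real_polynomial_function_eq in auto)
  then obtain y where y: "y \<in> cball z r" "\<And>x. x \<in> cball z r \<Longrightarrow> w x - h x \<le> w y - h y"
    using continuous_attains_sup[of "cball z r" "\<lambda>x. w x - h x"] x by fastforce
  have "y \<notin> ball z r"
  proof
    assume yb: "y \<in> ball z r"
    have "\<forall>\<^sub>F x in nhds y. x \<in> ball z r" using yb by (intro eventually_nhds_in_open) auto
    then have "\<forall>\<^sub>F x in nhds y. w x - h x \<le> w y - h y"
      by eventually_elim (use y in auto)
    then have "c \<le> lin_op a d h y" using sub h(1) yb unfolding lin_subsol_def by blast
    then show False using h(2)[of y] by simp
  qed
  then have "w y - h y \<le> s" using bd[of y] y(1) by (auto simp: not_less)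
  then show ?thesis using y(2)[OF x] by simp
qed

lemma rpoly_max_principle:
  assumes g: "rpoly g" "\<And>x. lin_op a d g x = 0" "\<And>x. x \<in> sphere z r \<Longrightarrow> g x = 0"
    and a: "a > 0" and x: "x \<in> cball z r"
  shows "g x \<le> 0"
proof (rule field_le_epsilon)
  fix e :: real assume e: "e > 0"
  \<comment> \<open>The comparison lemma needs a strict inequality for the operator, which a small
    concave quadratic supplies. The summand 1 keeps the denominator positive for every
    \<open>r\<close>, and the error \<open>k * r\<^sup>2\<close> stays below
    \<open>e\<close>.\<close>
  define k where "k = e / (r\<^sup>2 + 1)"
  have k: "k > 0" "k * r\<^sup>2 \<le> e"
    using e by (auto simp: k_def divide_simps add_nonneg_pos mult_left_mono)
  let ?h = "\<lambda>x. - k * (norm (x - z))\<^sup>2"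
  have "g x \<le> ?h x + k * r\<^sup>2"
  proof (rule lin_subsol_comparison[where c = 0, OF _ _ _ _ _ x])
    show "continuous_on (cball z r) g"
      using g(1) by (simp add: continuous_on_polymonial_function real_polynomial_function_eq)
    show "lin_subsol a d 0 (ball z r) g"
      unfolding lin_subsol_def using lin_op_local_max[OF g(1), where a = a and d = d] g(2) a by fastforce
    show "rpoly ?h" by (intro rpoly_mult rpoly_const rpoly_sqdist)
    have "0 < a * DIM('a) + d \<bullet> d" using a by (simp add: add_pos_nonneg)
    then show "lin_op a d ?h y < 0" for y
      using k(1) by (simp only: lin_op_cmult[OF rpoly_sqdist] lin_op_sqdist) (simp add: mult_pos_neg mult_pos_pos)
    show "g y \<le> ?h y + k * r\<^sup>2" if "y \<in> sphere z r" for y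
      using that g(3) by (simp add: dist_norm norm_minus_commute)
  qed
  also have "\<dots> \<le> 0 + e"
  proof -
    have "0 \<le> k * (norm (x - z))\<^sup>2" using k by simp
    then show ?thesis using k(2) by linarith
  qed
  finally show "g x \<le> 0 + e" .
qed

lemma rpoly_le_sqdist: "(\<lambda>x::'a::euclidean_space. (norm (x - z))\<^sup>2) \<in> rpoly_le 2"
proof -
  have "(\<lambda>x. x \<bullet> b - z \<bullet> b) \<in> rpoly_le (Suc 0)" for b
    by (intro rpoly_le_diff rpoly_le_const rpoly_le_linear bounded_linear_inner_left)
  from rpoly_le_sum[OF rpoly_le_mult[OF this this]]
  have "(\<lambda>x. \<Sum>b\<in>Basis. (x \<bullet> b - z \<bullet> b) * (x \<bullet> b - z \<bullet> b)) \<in> rpoly_le 2"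
    by (simp add: numeral_2_eq_2)
  moreover have "(\<lambda>x. (norm (x - z))\<^sup>2) = (\<lambda>x. \<Sum>b\<in>Basis. (x \<bullet> b - z \<bullet> b) * (x \<bullet> b - z \<bullet> b))"
    by (rule ext, subst power2_norm_eq_inner, subst euclidean_inner) (simp only: inner_diff_left)
  ultimately show ?thesis by simp
qed

text \<open>
  Multiplying by the defining polynomial of the sphere and applying the operator maps the
  polynomials of degree at most \<open>n\<close> to themselves, injectively by the maximum principle.
\<close>

lemma dirichlet_ball_rpoly:
  assumes "a > 0" "r > 0" "rpoly f"
  shows "\<exists>h. rpoly h \<and> (\<forall>x. lin_op a d h x = c) \<and> (\<forall>x\<in>sphere z r. h x = f x)"
proof -
  obtain n0 where "f \<in> rpoly_le n0" using rpoly_imp_rpoly_le[OF assms(3)] ..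
  \<comment> \<open>Raising the degree bound by two places \<open>lin_op a d f\<close> in
    \<open>rpoly_le n0\<close>, the space on which the endomorphism \<open>T\<close> acts.\<close>
  then have "f \<in> rpoly_le (Suc (Suc n0))" by (rule rpoly_le_mono[rotated]) simp
  then have f: "(\<lambda>x. lin_op a d f x - c) \<in> rpoly_le n0"
    by (intro rpoly_le_diff rpoly_le_const rpoly_le_lin_op)
  define m where "m = (\<lambda>x. r\<^sup>2 - (norm (x - z))\<^sup>2)"
  have m2: "m \<in> rpoly_le 2"
    unfolding m_def by (intro rpoly_le_diff rpoly_le_const rpoly_le_sqdist)
  have m: "rpoly m" by (rule rpoly_if_rpoly_le[OF m2])
  define T where "T = (\<lambda>q. lin_op a d (\<lambda>x. m x * q x))"
  have mq: "rpoly (\<lambda>x. m x * q x)" if "q \<in> rpoly_le n0" for q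
    using m rpoly_if_rpoly_le[OF that] by (rule rpoly_mult)
  have "\<exists>q\<in>fun_vs.span (monomials n0). T q = (\<lambda>x. lin_op a d f x - c)"
  proof (rule fun_vs.inj_imp_surj_on_finite_span[OF finite_monomials]; unfold rpoly_le_def[symmetric])
    show "T q \<in> rpoly_le n0" if "q \<in> rpoly_le n0" for q
      unfolding T_def using rpoly_le_lin_op[of _ n0] rpoly_le_mult[OF m2 that] by simp
    show "T (q + s) = T q + T s" if "q \<in> rpoly_le n0" "s \<in> rpoly_le n0" for q s
      unfolding T_def plus_fun_def
      by (rule ext) (simp add: distrib_left lin_op_add mq that)
    show "T (\<lambda>x. k * q x) = (\<lambda>x. k * T q x)" if "q \<in> rpoly_le n0" for q k
      unfolding T_def by (rule ext) (simp add: mult.left_commute[of _ k] lin_op_cmult mq that)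
    show "q = 0" if q: "q \<in> rpoly_le n0" "T q = 0" for q
    proof -
      have op: "lin_op a d (\<lambda>x. m x * q x) x = 0" for x
        using q(2) by (simp add: T_def fun_eq_iff)
      \<comment> \<open>The maximum principle applies to \<open>m * q\<close> and to its negative,
        since \<open>m\<close> vanishes on the sphere. Inside the ball \<open>m\<close> is positive
        and can be cancelled.\<close>
      have "q x = 0" if x: "x \<in> ball z r" for x
      proof -
        have "m x * q x \<le> 0"
          by (rule rpoly_max_principle[where d = d and z = z and r = r, OF mq[OF q(1)] op _ assms(1)])
             (use x in \<open>auto simp: m_def dist_norm norm_minus_commute\<close>)
        moreover have "- (m x * q x) \<le> 0"
          by (rule rpoly_max_principle[where d = d and g = "\<lambda>x. - (m x * q x)" and z = z and r = r, OF _ _ _ assms(1)])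
             (use x op in \<open>auto simp: m_def dist_norm norm_minus_commute lin_op_uminus mq[OF q(1), unfolded m_def]
               intro!: mq[OF q(1), unfolded m_def]\<close>)
        moreover have "m x > 0"
          using x by (auto simp: m_def dist_norm norm_minus_commute intro!: power_strict_mono)
        ultimately show ?thesis by (simp add: antisym)
      qed
      then show ?thesis
        using rpoly_eq_0_if_eq_0_on_ball[OF rpoly_if_rpoly_le[OF q(1)] assms(2), of z] by (auto simp: fun_eq_iff)
    qed
    show "(\<lambda>x. lin_op a d f x - c) \<in> rpoly_le n0" by (rule f)
  qed
  then obtain q where q: "q \<in> rpoly_le n0" "T q = (\<lambda>x. lin_op a d f x - c)"
    by (auto simp: rpoly_le_def)
  \<comment> \<open>The solution is \<open>f\<close> corrected by \<open>m * q\<close>, which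
    removes the error in the equation and leaves the values on the sphere unchanged.\<close>
  have "lin_op a d (\<lambda>x. f x - m x * q x) x = c" for x
    using fun_cong[OF q(2), of x] by (simp add: lin_op_diff assms mq q T_def)
  moreover have "rpoly (\<lambda>x. f x - m x * q x)"
    by (intro real_polynomial_function_diff assms mq q)
  moreover have "f x - m x * q x = f x" if "x \<in> sphere z r" for x
    using that by (simp add: m_def dist_norm norm_minus_commute)
  ultimately show ?thesis by (intro exI[of _ "\<lambda>x. f x - m x * q x"]) simp
qed

text \<open>
  A polynomial \<open>h\<close> with constant \<open>lin_op a d h\<close> separates \<open>w1\<close> from \<open>m - w2\<close>, where \<open>m\<close> is the
  maximum of \<open>w1 + w2\<close>; this replaces the theorem on sums.
\<close>

lemma lin_subsol_sum_no_max:
  fixes z :: "'a::euclidean_space"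
  assumes "a > 0" "r > 0"
    and w1: "continuous_on (cball z r) w1" "lin_subsol a d c1 (ball z r) w1"
    and w2: "continuous_on (cball z r) w2" "lin_subsol a d c2 (ball z r) w2"
    and c: "c1 + c2 > 0"
    and max: "\<And>x. x \<in> cball z r \<Longrightarrow> w1 x + w2 x \<le> w1 z + w2 z"
  shows False
proof -
  define S where "S = 2 * (a * DIM('a) + d \<bullet> d)"
  have S: "S > 0" using assms(1) by (simp add: S_def add_pos_nonneg)
  \<comment> \<open>The number \<open>(c1 - c2) / 2\<close>, prescribed below for \<open>h\<close>,
    is the midpoint of \<open>- c2\<close> and \<open>c1\<close>. The quadratic adds
    \<open>(c1 + c2) / 4\<close>, half of the gap, so both \<open>h + ?s\<close> and
    \<open>- h + ?s\<close> remain strict supersolutions.\<close>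
  define k where "k = (c1 + c2) / (4 * S)"
  have k: "k > 0" "k * S = (c1 + c2) / 4" using S c by (auto simp: k_def)
  have kr: "k * r\<^sup>2 > 0" using k assms by simp
  have "continuous_on (sphere z r) w1" using w1(1) by (rule continuous_on_subset) auto
  then obtain f where f: "rpoly f" "\<And>x. x \<in> sphere z r \<Longrightarrow> \<bar>w1 x - f x\<bar> < k * r\<^sup>2 / 4"
    using Stone_Weierstrass_real_polynomial_function[of "sphere z r" w1 "k * r\<^sup>2 / 4"] kr by auto
  obtain h where h: "rpoly h" "\<And>x. lin_op a d h x = (c1 - c2) / 2" "\<And>x. x \<in> sphere z r \<Longrightarrow> h x = f x"
    using dirichlet_ball_rpoly[OF assms(1,2) f(1), of d "(c1 - c2) / 2" z] by auto
  let ?s = "\<lambda>x. k * (norm (x - z))\<^sup>2"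
  have s: "rpoly ?s" by (intro rpoly_mult rpoly_const rpoly_sqdist)
  have ops: "lin_op a d ?s x = (c1 + c2) / 4" for x
    using k by (simp add: lin_op_cmult rpoly_sqdist lin_op_sqdist S_def)
  have sph: "?s x = k * r\<^sup>2" if "x \<in> sphere z r" for x
    using that by (simp add: dist_norm norm_minus_commute)
  have z: "z \<in> cball z r" using assms(2) by simp
  \<comment> \<open>On the sphere the quadratic gains \<open>k * r\<^sup>2\<close>, of which the
    polynomial approximation uses up a quarter. At the centre the quadratic vanishes and
    \<open>h z\<close> cancels, so the two bounds together lose
    \<open>3/2 * (k * r\<^sup>2)\<close>, which is impossible.\<close>
  have "w1 z \<le> (h z + ?s z) + (- (3/4) * (k * r\<^sup>2))"
  proof (rule lin_subsol_comparison[where h = "\<lambda>x. h x + ?s x" and s = "- (3/4) * (k * r\<^sup>2)", OF w1 _ _ _ z])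
    show "rpoly (\<lambda>x. h x + ?s x)" by (intro rpoly_add h s)
    show "lin_op a d (\<lambda>x. h x + ?s x) x < c1" for x
      using c by (simp add: lin_op_add h s ops field_simps)
    show "w1 x \<le> h x + ?s x + - (3/4) * (k * r\<^sup>2)" if "x \<in> sphere z r" for x
      using f(2)[OF that] h(3)[OF that] sph[OF that] unfolding abs_less_iff by linarith
  qed
  moreover have "w2 z \<le> (- h z + ?s z) + (w1 z + w2 z - (3/4) * (k * r\<^sup>2))"
  proof (rule lin_subsol_comparison[where h = "\<lambda>x. - h x + ?s x" and s = "w1 z + w2 z - (3/4) * (k * r\<^sup>2)", OF w2 _ _ _ z])
    show "rpoly (\<lambda>x. - h x + ?s x)" by (intro rpoly_add real_polynomial_function_minus h s)
    show "lin_op a d (\<lambda>x. - h x + ?s x) x < c2" for x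
      using c unfolding lin_op_add[OF real_polynomial_function_minus[OF h(1)] s] lin_op_uminus[OF h(1)] ops h(2)
      by (simp add: field_simps)
    show "w2 x \<le> - h x + ?s x + (w1 z + w2 z - (3/4) * (k * r\<^sup>2))" if "x \<in> sphere z r" for x
      using f(2)[OF that] h(3)[OF that] sph[OF that] max[OF subsetD[OF sphere_cball that]]
      unfolding abs_less_iff by linarith
  qed
  ultimately show False using kr by simp
qed

section \<open>Upper semicontinuous functions on compact sets\<close>

lemma usc_onD_nhds:
  assumes "usc_on S w" "z \<in> S" "w z < a"
  shows "\<forall>\<^sub>F y in nhds z. y \<in> S \<longrightarrow> w y < a"
proof -
  have "\<forall>\<^sub>F y in nhds z. y \<noteq> z \<longrightarrow> y \<in> S \<longrightarrow> w y < a"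
    using assms unfolding usc_on_def eventually_at_filter by blast
  then show ?thesis by eventually_elim (use assms in auto)
qed

lemma usc_onI_nhds:
  assumes "\<And>z a. z \<in> S \<Longrightarrow> w z < a \<Longrightarrow> \<forall>\<^sub>F y in nhds z. y \<in> S \<longrightarrow> w y < a"
  shows "usc_on S w"
  unfolding usc_on_def eventually_at_filter
proof safe
  fix z a assume "z \<in> S" "w z < a"
  from assms[OF this] show "\<forall>\<^sub>F y in nhds z. y \<noteq> z \<longrightarrow> y \<in> S \<longrightarrow> w y < a"
    by eventually_elim simp
qed

lemma usc_on_subset: "usc_on S w \<Longrightarrow> T \<subseteq> S \<Longrightarrow> usc_on T w"
proof (rule usc_onI_nhds)
  fix z a assume "usc_on S w" "T \<subseteq> S" "z \<in> T" "w z < a"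
  then have "\<forall>\<^sub>F y in nhds z. y \<in> S \<longrightarrow> w y < a" by (intro usc_onD_nhds) auto
  then show "\<forall>\<^sub>F y in nhds z. y \<in> T \<longrightarrow> w y < a"
    by eventually_elim (use \<open>T \<subseteq> S\<close> in auto)
qed

lemma usc_on_compose:
  assumes w: "usc_on S w" and g: "continuous_on T g" "g ` T \<subseteq> S"
  shows "usc_on T (\<lambda>x. w (g x))"
  unfolding usc_on_def
proof safe
  fix z a assume z: "z \<in> T" "w (g z) < a"
  have "\<forall>\<^sub>F y in nhds (g z). y \<in> S \<longrightarrow> w y < a"
    using z g by (intro usc_onD_nhds[OF w]) auto
  moreover have "(g \<longlongrightarrow> g z) (at z within T)" using g z by (simp add: continuous_on_def)
  ultimately have "\<forall>\<^sub>F y in at z within T. g y \<in> S \<longrightarrow> w (g y) < a"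
    by (rule eventually_compose_filterlim)
  moreover have "\<forall>\<^sub>F y in at z within T. y \<in> T" by (simp add: eventually_at_filter)
  ultimately show "\<forall>\<^sub>F y in at z within T. w (g y) < a"
    by eventually_elim (use g in auto)
qed

lemma continuous_imp_usc_on: "continuous_on S w \<Longrightarrow> usc_on S w"
  unfolding usc_on_def continuous_on_def by (blast intro: order_tendstoD(2))

lemma usc_on_add:
  assumes "usc_on S w1" "usc_on S w2" shows "usc_on S (\<lambda>x. w1 x + w2 x)"
  unfolding usc_on_def
proof safe
  fix z a assume z: "z \<in> S" "w1 z + w2 z < a"
  define e where "e = (a - (w1 z + w2 z)) / 2"
  have "\<forall>\<^sub>F y in at z within S. w1 y < w1 z + e" "\<forall>\<^sub>F y in at z within S. w2 y < w2 z + e"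
    using assms z by (auto simp: usc_on_def e_def)
  then show "\<forall>\<^sub>F y in at z within S. w1 y + w2 y < a"
    by eventually_elim (simp add: e_def field_simps)
qed

lemma usc_on_cmult:
  assumes "usc_on S w" "c > 0" shows "usc_on S (\<lambda>x. c * w x)"
  unfolding usc_on_def
proof safe
  fix z a assume z: "z \<in> S" "c * w z < a"
  then have "w z < a / c" using assms by (simp add: field_simps)
  then have "\<forall>\<^sub>F y in at z within S. w y < a / c" using assms z by (auto simp: usc_on_def)
  then show "\<forall>\<^sub>F y in at z within S. c * w y < a"
    by eventually_elim (use assms in \<open>simp add: field_simps\<close>)
qed

lemma usc_on_uminus: "lsc_on S w \<Longrightarrow> usc_on S (\<lambda>x. - w x)"
  unfolding usc_on_def lsc_on_def
proof safe
  fix z a assume w: "\<forall>z\<in>S. \<forall>a<w z. \<forall>\<^sub>F y in at z within S. a < w y" and z: "z \<in> S" "- w z < a"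
  then have "\<forall>\<^sub>F y in at z within S. - a < w y" by simp
  then show "\<forall>\<^sub>F y in at z within S. - w y < a" by eventually_elim simp
qed

text \<open>If every \<open>y\<close> has some \<open>g y\<close> with a larger value, the sets
  where \<open>w\<close> is below \<open>w (g y)\<close> form an open cover. In a finite subcover
  take the largest of the values \<open>w (g y)\<close>: the point \<open>g y\<close> attaining it
  lies in one of the covering sets, and this gives a still larger value.\<close>

lemma usc_on_attains_max:
  fixes S :: "'a::topological_space set" and w :: "'a \<Rightarrow> real"
  assumes "compact S" "S \<noteq> {}" "usc_on S w"
  shows "\<exists>y\<in>S. \<forall>x\<in>S. w x \<le> w y"
proof (rule ccontr)
  assume "\<not> ?thesis"
  then obtain g where g: "\<And>y. y \<in> S \<Longrightarrow> g y \<in> S \<and> w y < w (g y)"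
    unfolding bex_simps ball_simps not_le by metis
  have "\<exists>G. open G \<and> y \<in> G \<and> (\<forall>x\<in>G \<inter> S. w x < w (g y))" if y: "y \<in> S" for y
    using usc_onD_nhds[OF assms(3) y, of "w (g y)"] g[OF y] unfolding eventually_nhds by blast
  then have "\<forall>y\<in>S. \<exists>G. open G \<and> y \<in> G \<and> (\<forall>x\<in>G \<inter> S. w x < w (g y))" by blast
  from bchoice[OF this]
  obtain G where G: "\<forall>y\<in>S. open (G y) \<and> y \<in> G y \<and> (\<forall>x\<in>G y \<inter> S. w x < w (g y))" ..
  have op: "open (G y)" if "y \<in> S" for y using bspec[OF G that] by simp
  have cov: "S \<subseteq> (\<Union>y\<in>S. G y)" using G by auto
  obtain F where F: "F \<subseteq> S" "finite F" "S \<subseteq> (\<Union>y\<in>F. G y)"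
    by (rule compactE_image[OF assms(1) op cov]) auto
  then have "F \<noteq> {}" using assms(2) by auto
  define M where "M = Max ((\<lambda>y. w (g y)) ` F)"
  have "M \<in> (\<lambda>y. w (g y)) ` F" unfolding M_def using F \<open>F \<noteq> {}\<close> by (intro Max_in) auto
  then obtain y where y: "y \<in> F" "M = w (g y)" by auto
  have "g y \<in> S" using g F y by auto
  then obtain x where x: "x \<in> F" "g y \<in> G x" using F by auto
  then have "w (g y) < w (g x)" using bspec[OF G, of x] F \<open>g y \<in> S\<close> by auto
  also have "\<dots> \<le> M" unfolding M_def using x F by (intro Max_ge) auto
  finally show False using y by simp
qed

section \<open>Sup-convolution\<close>

definition sup_conv :: "real \<Rightarrow> 'a::real_normed_vector set \<Rightarrow> ('a \<Rightarrow> real) \<Rightarrow> 'a \<Rightarrow> real" where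
  "sup_conv c K w z = (SUP y\<in>K. w y - c * (norm (y - z))\<^sup>2)"

lemma sup_conv_attained:
  fixes K :: "'a::euclidean_space set"
  assumes "compact K" "K \<noteq> {}" "usc_on K w"
  shows "\<exists>y\<in>K. sup_conv c K w z = w y - c * (norm (y - z))\<^sup>2"
    and "x \<in> K \<Longrightarrow> w x - c * (norm (x - z))\<^sup>2 \<le> sup_conv c K w z"
proof -
  let ?f = "\<lambda>y. w y + - c * (norm (y - z))\<^sup>2"
  have "usc_on K ?f"
    by (intro usc_on_add assms continuous_imp_usc_on continuous_intros)
  then obtain y where y: "y \<in> K" "\<And>x. x \<in> K \<Longrightarrow> ?f x \<le> ?f y"
    using usc_on_attains_max[OF assms(1,2)] by blast
  have eq: "sup_conv c K w z = w y - c * (norm (y - z))\<^sup>2"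
    unfolding sup_conv_def using y by (intro cSup_eq_maximum) auto
  then show "\<exists>y\<in>K. sup_conv c K w z = w y - c * (norm (y - z))\<^sup>2" using y by auto
  show "w x - c * (norm (x - z))\<^sup>2 \<le> sup_conv c K w z" if "x \<in> K"
    using y(2)[OF that] eq by simp
qed

text \<open>A maximizer for \<open>a\<close> is a competitor for \<open>b\<close>. The difference of
  the two penalties factors into an inner product with \<open>a - b\<close>, which yields a local
  Lipschitz estimate.\<close>

lemma isCont_sup_conv:
  fixes K :: "'a::euclidean_space set"
  assumes K: "compact K" "K \<noteq> {}" "usc_on K w" and c: "c > 0"
  shows "isCont (sup_conv c K w) z"
proof -
  obtain R where R: "\<And>y. y \<in> K \<Longrightarrow> norm y \<le> R"
    using compact_imp_bounded[OF K(1)] by (auto simp: bounded_iff)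
  have step: "sup_conv c K w a - sup_conv c K w b \<le> c * (norm (a - b) * (2 * R + norm a + norm b))" for a b
  proof -
    obtain y where y: "y \<in> K" "sup_conv c K w a = w y - c * (norm (y - a))\<^sup>2"
      using sup_conv_attained(1)[OF K] by blast
    have "sup_conv c K w b \<ge> w y - c * (norm (y - b))\<^sup>2"
      using sup_conv_attained(2)[OF K y(1)] .
    then have "sup_conv c K w a - sup_conv c K w b \<le> c * ((norm (y - b))\<^sup>2 - (norm (y - a))\<^sup>2)"
      using y by (simp add: algebra_simps)
    also have "(norm (y - b))\<^sup>2 - (norm (y - a))\<^sup>2 = (a - b) \<bullet> (2 *\<^sub>R y - a - b)"
      by (simp add: power2_norm_eq_inner inner_diff inner_commute algebra_simps)
    also have "\<dots> \<le> norm (a - b) * norm (2 *\<^sub>R y - a - b)" by (rule norm_cauchy_schwarz)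
    also have "norm (2 *\<^sub>R y - a - b) \<le> 2 * R + norm a + norm b"
      using norm_triangle_ineq4[of "2 *\<^sub>R y - a" b] norm_triangle_ineq4[of "2 *\<^sub>R y" a] R[OF y(1)] by simp
    finally show ?thesis using c by (simp add: mult_left_mono)
  qed
  have "((\<lambda>x. sup_conv c K w x - sup_conv c K w z) \<longlongrightarrow> 0) (at z)"
  proof (rule Lim_null_comparison)
    show "\<forall>\<^sub>F x in at z. norm (sup_conv c K w x - sup_conv c K w z)
        \<le> c * (norm (x - z) * (2 * R + norm x + norm z))"
    proof (rule always_eventually, rule allI)
      fix x
      have "norm (z - x) * (2 * R + norm z + norm x) = norm (x - z) * (2 * R + norm x + norm z)"
        by (simp add: norm_minus_commute)
      then show "norm (sup_conv c K w x - sup_conv c K w z) \<le> c * (norm (x - z) * (2 * R + norm x + norm z))"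
        using step[of x z] step[of z x] unfolding real_norm_def abs_le_iff by simp
    qed
    have "((\<lambda>x. c * (norm (x - z) * (2 * R + norm x + norm z)))
        \<longlongrightarrow> c * (norm (z - z) * (2 * R + norm z + norm z))) (at z)"
      by (intro tendsto_intros)
    then show "((\<lambda>x. c * (norm (x - z) * (2 * R + norm x + norm z))) \<longlongrightarrow> 0) (at z)" by simp
  qed
  then show ?thesis unfolding isCont_def by (rule LIM_zero_cancel)
qed

lemma isCont_eventually_greater:
  fixes g :: "'a::t2_space \<Rightarrow> real"
  shows "isCont g z \<Longrightarrow> a < g z \<Longrightarrow> \<forall>\<^sub>F x in nhds z. a < g x"
  unfolding isCont_def tendsto_at_iff_tendsto_nhds by (rule order_tendstoD(1))

text \<open>At \<open>z0\<close> the supremum over \<open>K - N\<close> is strictly smaller than the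
  supremum over \<open>K\<close>, by uniqueness of the maximizer. Both sup-convolutions are
  continuous, so the strict inequality persists nearby.\<close>

lemma sup_conv_maximizers_near:
  fixes K :: "'a::euclidean_space set"
  assumes K: "compact K" "usc_on K w" and c: "c > 0"
    and y1: "y1 \<in> K"
    and uniq: "\<And>y. y \<in> K \<Longrightarrow> sup_conv c K w z0 = w y - c * (norm (y - z0))\<^sup>2 \<Longrightarrow> y = y1"
    and N: "open N" "y1 \<in> N"
  shows "\<forall>\<^sub>F z in nhds z0. \<forall>y\<in>K. sup_conv c K w z = w y - c * (norm (y - z))\<^sup>2 \<longrightarrow> y \<in> N"
proof (cases "K - N = {}")
  case False
  have ne: "K \<noteq> {}" using y1 by auto
  have K': "compact (K - N)" "K - N \<noteq> {}" "usc_on (K - N) w"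
    using K N False usc_on_subset[OF K(2), of "K - N"] by (auto intro: compact_diff)
  obtain y where y: "y \<in> K - N" "sup_conv c (K - N) w z0 = w y - c * (norm (y - z0))\<^sup>2"
    using sup_conv_attained(1)[OF K'] by blast
  have "sup_conv c (K - N) w z0 < sup_conv c K w z0"
    using sup_conv_attained(2)[OF K(1) ne K(2), of y c z0] uniq[of y] y N by force
  moreover have "isCont (\<lambda>z. sup_conv c K w z - sup_conv c (K - N) w z) z0"
    by (intro continuous_intros isCont_sup_conv K' K ne c)
  ultimately have "\<forall>\<^sub>F z in nhds z0. 0 < sup_conv c K w z - sup_conv c (K - N) w z"
    by (intro isCont_eventually_greater) simp_all
  then show ?thesis
  proof eventually_elim
    case (elim z)
    show ?case
    proof safe
      fix y assume y: "y \<in> K" "sup_conv c K w z = w y - c * (norm (y - z))\<^sup>2"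
      show "y \<in> N"
        using sup_conv_attained(2)[OF K', of y c z] y elim by (cases "y \<in> N") auto
    qed
  qed
next
  case True
  then show ?thesis by (intro always_eventually) blast
qed

section \<open>Quasilinear operators and linearization at sup-convolutions\<close>

definition grad :: "('a::euclidean_space \<Rightarrow> real) \<Rightarrow> 'a \<Rightarrow> 'a" where
  "grad q z = (\<Sum>b\<in>Basis. dir_deriv b q z *\<^sub>R b)"

lemma dir_deriv_eq_grad:
  assumes "rpoly q" shows "dir_deriv v q z = grad q z \<bullet> v"
proof -
  interpret linear "\<lambda>v. dir_deriv v q z" by (rule dir_deriv_linear[OF assms])
  have "dir_deriv v q z = dir_deriv (\<Sum>b\<in>Basis. (v \<bullet> b) *\<^sub>R b) q z"
    by (simp add: euclidean_representation)
  then show ?thesis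
    by (simp add: sum scale grad_def inner_sum_left inner_commute[of v] mult.commute)
qed

lemma grad_eqI: "rpoly q \<Longrightarrow> (\<And>v. dir_deriv v q z = P \<bullet> v) \<Longrightarrow> grad q z = P"
  by (metis dir_deriv_eq_grad vector_eq_rdot)

text \<open>The coefficients depend on the gradient alone, and freezing it turns the second-order
  part into a \<open>lin_op\<close>.\<close>

definition quasi_op ::
  "('a::euclidean_space \<Rightarrow> real) \<Rightarrow> ('a \<Rightarrow> 'a) \<Rightarrow> ('a \<Rightarrow> real) \<Rightarrow> ('a \<Rightarrow> real) \<Rightarrow> 'a \<Rightarrow> real" where
  "quasi_op A d B q z = lin_op (A (grad q z)) (d (grad q z)) q z + B (grad q z)"

text \<open>Restricting the test functions to polynomials weakens the notion, so the comparison
  theorem for it covers subsolutions tested with all \<open>C^2\<close> functions; every barrier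
  constructed here is a polynomial.\<close>

definition visc_subsol ::
  "('a::euclidean_space \<Rightarrow> real) \<Rightarrow> ('a \<Rightarrow> 'a) \<Rightarrow> ('a \<Rightarrow> real) \<Rightarrow> ('a \<Rightarrow> real) \<Rightarrow> 'a set \<Rightarrow> ('a \<Rightarrow> real) \<Rightarrow> bool"
  where
  "visc_subsol A d B h N w \<longleftrightarrow> (\<forall>q z. rpoly q \<and> z \<in> N \<and> (\<forall>\<^sub>F y in nhds z. w y - q y \<le> w z - q z) \<longrightarrow>
     h z \<le> quasi_op A d B q z)"

text \<open>Positivity on \<open>b + c\<close> and \<open>b - c\<close> bounds each matrix entry by
  the mean of two diagonal entries, hence by the trace. Expanding \<open>H x y\<close> in
  coordinates then gives \<open>DIM('a)\<close> squared terms.\<close>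

lemma psd_bilinear_bound:
  fixes H :: "'a::euclidean_space \<Rightarrow> 'a \<Rightarrow> real"
  assumes bil: "bilinear H" and sym: "\<And>x y. H x y = H y x" and psd: "\<And>x. 0 \<le> H x x"
  shows "\<bar>H x y\<bar> \<le> (DIM('a))\<^sup>2 * (\<Sum>b\<in>Basis. H b b) * (norm x * norm y)"
proof -
  let ?T = "\<Sum>b\<in>Basis. H b b"
  have entry: "\<bar>H b c\<bar> \<le> ?T" if "b \<in> Basis" "c \<in> Basis" for b c
  proof -
    have "0 \<le> H (b + c) (b + c)" "0 \<le> H (b - c) (b - c)" by (rule psd)+
    then have "2 * \<bar>H b c\<bar> \<le> H b b + H c c"
      using sym[of b c] by (simp add: bilinear_ladd[OF bil] bilinear_radd[OF bil] bilinear_lsub[OF bil] bilinear_rsub[OF bil])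
    moreover have "H b b \<le> ?T" "H c c \<le> ?T"
      using that psd by (auto intro: member_le_sum)
    ultimately show ?thesis by simp
  qed
  have "H x y = H (\<Sum>b\<in>Basis. (x \<bullet> b) *\<^sub>R b) (\<Sum>b\<in>Basis. (y \<bullet> b) *\<^sub>R b)"
    by (simp add: euclidean_representation)
  also have "\<dots> = (\<Sum>(b, c)\<in>Basis \<times> Basis. (x \<bullet> b) * (y \<bullet> c) * H b c)"
    by (simp add: bilinear_sum[OF bil] bilinear_lmul[OF bil] bilinear_rmul[OF bil] mult.assoc mult.left_commute)
  finally have "\<bar>H x y\<bar> \<le> (\<Sum>(b, c)\<in>Basis \<times> Basis. \<bar>(x \<bullet> b) * (y \<bullet> c) * H b c\<bar>)"
    by (simp add: case_prod_unfold sum_abs)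
  also have "\<dots> \<le> (\<Sum>(b, c)\<in>(Basis::'a set) \<times> (Basis::'a set). norm x * norm y * ?T)"
  proof (rule sum_mono, clarify)
    fix b c :: 'a assume "b \<in> Basis" "c \<in> Basis"
    then show "\<bar>(x \<bullet> b) * (y \<bullet> c) * H b c\<bar> \<le> norm x * norm y * ?T"
      unfolding abs_mult by (intro mult_mono entry Basis_le_norm) auto
  qed
  also have "\<dots> = (DIM('a))\<^sup>2 * ?T * (norm x * norm y)"
    by (simp add: power2_eq_square card_cartesian_product)
  finally show ?thesis .
qed

text \<open>The multiple of the inner product is the shift that makes the Hessian of a function
  touching a sup-convolution from above positive semidefinite; \<open>k = 0\<close> gives the plain
  Hessian.\<close>

lemma bilinear_hessian:
  assumes "rpoly q" shows "bilinear (\<lambda>v w. dir_deriv v (dir_deriv w q) z + k * (v \<bullet> w))"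
  unfolding bilinear_def
proof (intro conjI allI)
  fix v
  show "linear (\<lambda>w. dir_deriv v (dir_deriv w q) z + k * (v \<bullet> w))"
    by (rule linearI)
      (simp_all add: dir_deriv_add_dir dir_deriv_scale_dir dir_deriv_add dir_deriv_cmult rpoly_dir_deriv assms
        inner_add_right algebra_simps)
  show "linear (\<lambda>w. dir_deriv w (dir_deriv v q) z + k * (w \<bullet> v))"
    by (rule linearI)
      (simp_all add: dir_deriv_add_dir dir_deriv_scale_dir rpoly_dir_deriv assms inner_add_left algebra_simps)
qed

lemma lin_op_hessian_shift:
  fixes q :: "'a::euclidean_space \<Rightarrow> real"
  shows "lin_op a d q z = a * (\<Sum>b\<in>Basis. dir_deriv b (dir_deriv b q) z + k * (b \<bullet> b))
    + (dir_deriv d (dir_deriv d q) z + k * (d \<bullet> d)) - k * (a * DIM('a) + d \<bullet> d)"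
  by (simp add: lin_op_def laplacian_def sum.distrib inner_Basis algebra_simps)

text \<open>
  Where the Hessian is bounded below, an operator with coefficients close to \<open>(a0, d0)\<close> differs
  from \<open>lin_op a0 d0\<close> by a small multiple of \<open>lin_op a0 d0\<close> itself, so no upper bound on the Hessian is needed.
\<close>

lemma lin_op_perturb:
  fixes q :: "'a::euclidean_space \<Rightarrow> real" and d d0 :: 'a and a a0 k :: real
  assumes q: "rpoly q" and psd: "\<And>v. 0 \<le> dir_deriv v (dir_deriv v q) z + k * (v \<bullet> v)"
    and a0: "a0 > 0"
  defines "\<rho> \<equiv> \<bar>a - a0\<bar> + (DIM('a))\<^sup>2 * (norm (d - d0) * norm (d + d0))"
  shows "lin_op a d q z + k * (a * DIM('a) + d \<bullet> d)
    \<le> (1 + \<rho> / a0) * (lin_op a0 d0 q z + k * (a0 * DIM('a) + d0 \<bullet> d0))"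
proof -
  define H where "H = (\<lambda>v w. dir_deriv v (dir_deriv w q) z + k * (v \<bullet> w))"
  have bil: "bilinear H" unfolding H_def by (rule bilinear_hessian[OF q])
  have sym: "H v w = H w v" for v w
    using dir_deriv_commute[OF q, of v w] by (simp add: H_def inner_commute)
  have psd': "0 \<le> H v v" for v unfolding H_def by (rule psd)
  define T where "T = (\<Sum>b\<in>Basis. H b b)"
  have T: "T \<ge> 0" unfolding T_def by (intro sum_nonneg psd')
  \<comment> \<open>This is the operator evaluated on the shifted, positive semidefinite Hessian
    \<open>H\<close> with trace \<open>T\<close>.\<close>
  define S where "S = (\<lambda>a d. a * T + H d d)"
  have S: "lin_op a d q z + k * (a * DIM('a) + d \<bullet> d) = S a d" for a d
    unfolding S_def T_def H_def by (subst lin_op_hessian_shift[of _ _ _ _ k]) simp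
  have "H d d - H d0 d0 = H (d - d0) (d + d0)"
    using sym[of d d0] by (simp add: bilinear_ladd[OF bil] bilinear_radd[OF bil] bilinear_lsub[OF bil] bilinear_rsub[OF bil])
  also have "\<dots> \<le> (DIM('a))\<^sup>2 * T * (norm (d - d0) * norm (d + d0))"
    using psd_bilinear_bound[OF bil sym psd', of "d - d0" "d + d0"] unfolding T_def by simp
  finally have "S a d - S a0 d0 \<le> (a - a0) * T + (DIM('a))\<^sup>2 * T * (norm (d - d0) * norm (d + d0))"
    by (simp add: S_def algebra_simps)
  also have "(a - a0) * T \<le> \<bar>a - a0\<bar> * T" using T by (intro mult_right_mono) auto
  finally have "S a d - S a0 d0 \<le> \<rho> * T" by (simp add: \<rho>_def algebra_simps)
  moreover have "\<rho> * T \<le> \<rho> * (S a0 d0 / a0)"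
    using a0 psd' by (intro mult_left_mono) (auto simp: S_def \<rho>_def field_simps)
  ultimately have "S a d \<le> (1 + \<rho> / a0) * S a0 d0" by (simp add: algebra_simps)
  then show ?thesis unfolding S .
qed

text \<open>A test function touching the sup-convolution at \<open>z\<close> can be translated so as
  to touch \<open>w\<close> at a maximizer \<open>y\<close>, with the same derivatives. Its gradient
  there is \<open>2 * c\<close> times \<open>y - z\<close>, hence close to \<open>P0\<close>, and
  its Hessian is at least \<open>- 2 * c\<close>; \<open>lin_op_perturb\<close> then allows the
  coefficients to be frozen at \<open>P0\<close>.\<close>

lemma sup_conv_lin_subsol:
  fixes K :: "'a::euclidean_space set"
  assumes K: "compact K" "usc_on K w" and c: "c > 0"
    and N: "open N" "N \<subseteq> K" "y1 \<in> N"
    and sub: "visc_subsol A d B (\<lambda>_. \<gamma>) N w"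
    and uniq: "\<And>y. y \<in> K \<Longrightarrow> sup_conv c K w z0 = w y - c * (norm (y - z0))\<^sup>2 \<Longrightarrow> y = y1"
    and P0: "P0 = (2 * c) *\<^sub>R (y1 - z0)"
    and cont: "isCont A P0" "isCont d P0" "isCont B P0" and A: "A P0 > 0"
    and \<gamma>': "\<gamma>' < \<gamma> - B P0"
  shows "\<exists>r>0. lin_subsol (A P0) (d P0) \<gamma>' (ball z0 r) (sup_conv c K w)"
proof -
  have ne: "K \<noteq> {}" using N by auto
  let ?W = "sup_conv c K w"
  define k where "k = 2 * c"
  define \<rho> where "\<rho> = (\<lambda>P. \<bar>A P - A P0\<bar> + (DIM('a))\<^sup>2 * (norm (d P - d P0) * norm (d P + d P0)))"
  define R where "R = (\<lambda>P. (\<gamma> - B P + k * (A P * DIM('a) + d P \<bullet> d P)) / (1 + \<rho> P / A P0)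
      - k * (A P0 * DIM('a) + d P0 \<bullet> d P0))"
  have \<rho>0: "\<rho> P0 = 0" by (simp add: \<rho>_def)
  have \<rho>_nonneg: "\<rho> P \<ge> 0" for P by (simp add: \<rho>_def)
  have "isCont R P0"
    unfolding R_def using A \<rho>0 by (intro continuous_intros cont) (auto simp: \<rho>_def intro!: continuous_intros cont)
  moreover have "\<gamma>' < R P0" using \<gamma>' \<rho>0 by (simp add: R_def)
  ultimately have evR: "\<forall>\<^sub>F P in nhds P0. \<gamma>' < R P" by (rule isCont_eventually_greater)
  then obtain e where e: "e > 0" "\<And>P. dist P P0 < e \<Longrightarrow> \<gamma>' < R P"
    by (auto simp: eventually_nhds_metric)
  \<comment> \<open>The gradient is \<open>2 * c\<close> times \<open>y - z\<close>. If
    \<open>y\<close> and \<open>z\<close> both move by less than \<open>s\<close>, it changes by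
    less than \<open>2 * c * (s + s) = e\<close>.\<close>
  define s where "s = e / (4 * c)"
  have s: "s > 0" using e c by (simp add: s_def)
  have "\<forall>\<^sub>F z in nhds z0. \<forall>y\<in>K. ?W z = w y - c * (norm (y - z))\<^sup>2 \<longrightarrow> y \<in> N \<inter> ball y1 s"
    by (rule sup_conv_maximizers_near[OF K c _ uniq]) (use N s in auto)
  then obtain r0 where r0: "r0 > 0"
    "\<And>z y. dist z z0 < r0 \<Longrightarrow> y \<in> K \<Longrightarrow> ?W z = w y - c * (norm (y - z))\<^sup>2 \<Longrightarrow> y \<in> N \<inter> ball y1 s"
    unfolding eventually_nhds_metric by blast
  define r where "r = min r0 s"
  have "lin_subsol (A P0) (d P0) \<gamma>' (ball z0 r) ?W"
    unfolding lin_subsol_def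
  proof (intro allI impI, elim conjE)
    fix q z assume q: "rpoly q" and z: "z \<in> ball z0 r"
      and max: "\<forall>\<^sub>F y in nhds z. ?W y - q y \<le> ?W z - q z"
    obtain y where y: "y \<in> K" "?W z = w y - c * (norm (y - z))\<^sup>2"
      using sup_conv_attained(1)[OF K(1) ne K(2)] by blast
    have yN: "y \<in> N" "y \<in> ball y1 s"
      using r0(2)[OF _ y] z by (auto simp: r_def dist_commute)
    define P where "P = k *\<^sub>R (y - z)"
    \<comment> \<open>Up to a constant, this paraboloid lies below the sup-convolution and meets it
      at \<open>z\<close>. Comparing \<open>q\<close> with it determines the gradient of
      \<open>q\<close> and bounds its Hessian from below.\<close>
    let ?p = "\<lambda>x. - c * (norm (x - y))\<^sup>2"
    have p: "rpoly ?p" by (intro rpoly_mult rpoly_const rpoly_sqdist)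
    have dp: "dir_deriv v ?p = (\<lambda>x. - c * (2 * ((x - y) \<bullet> v)))" for v
      by (simp only: dir_deriv_cmult[OF rpoly_sqdist] dir_deriv_sqdist)
    have ddp: "dir_deriv v (dir_deriv v ?p) = (\<lambda>x. - c * (2 * (v \<bullet> v)))" for v
      by (simp only: dir_deriv_cmult[OF rpoly_sqdist] dir_deriv_cmult[OF rpoly_dir_deriv[OF rpoly_sqdist]] dir_deriv2_sqdist)
    have "\<forall>\<^sub>F x in nhds z. ?p x - q x \<le> ?p z - q z"
      using max
    proof eventually_elim
      case (elim x)
      then show ?case
        using sup_conv_attained(2)[OF K(1) ne K(2) y(1), of c x] y(2) by (simp add: norm_minus_commute)
    qed
    note pq = rpoly_local_max_diff[OF p q this]
    have gradq: "grad q z = P"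
    proof (rule grad_eqI[OF q])
      show "dir_deriv v q z = P \<bullet> v" for v
        using pq(1)[of v] unfolding dp by (simp add: P_def k_def inner_diff_left algebra_simps)
    qed
    have psd: "0 \<le> dir_deriv v (dir_deriv v q) z + k * (v \<bullet> v)" for v
      using pq(2)[of v] unfolding ddp by (simp add: k_def)
    \<comment> \<open>Using \<open>x\<close> as competitor at the point \<open>x + (z - y)\<close>
      keeps the penalty constant, so the translate of \<open>q\<close> touches \<open>w\<close> from
      above at \<open>y\<close>.\<close>
    have "\<gamma> \<le> quasi_op A d B (\<lambda>x. q (x + (z - y))) y"
    proof -
      have "\<forall>\<^sub>F x in nhds y. w x - q (x + (z - y)) \<le> w y - q (y + (z - y))"
      proof -
        have "((\<lambda>x. x + (z - y)) \<longlongrightarrow> y + (z - y)) (nhds y)"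
          by (intro tendsto_intros filterlim_ident)
        then have "\<forall>\<^sub>F x in nhds y. ?W (x + (z - y)) - q (x + (z - y)) \<le> ?W z - q z"
          using max by (auto intro: eventually_compose_filterlim)
        moreover have "\<forall>\<^sub>F x in nhds y. x \<in> N" using N yN by (simp add: eventually_nhds_in_open)
        ultimately show ?thesis
        proof eventually_elim
          case (elim x)
          then have "w x - c * (norm (x - (x + (z - y))))\<^sup>2 \<le> ?W (x + (z - y))"
            using N by (intro sup_conv_attained(2)[OF K(1) ne K(2)]) auto
          then show ?case using elim y(2) by (simp add: norm_minus_commute)
        qed
      qed
      then show ?thesis
        using sub rpoly_affine[OF q] yN unfolding visc_subsol_def by blast
    qed
    also have "\<dots> = lin_op (A P) (d P) q z + B P"
      using gradq
      by (simp add: quasi_op_def grad_def lin_op_def laplacian_def dir_deriv_translate q rpoly_dir_deriv)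
    finally have "\<gamma> - B P + k * (A P * DIM('a) + d P \<bullet> d P)
        \<le> lin_op (A P) (d P) q z + k * (A P * DIM('a) + d P \<bullet> d P)" by simp
    also have "\<dots> \<le> (1 + \<rho> P / A P0) * (lin_op (A P0) (d P0) q z + k * (A P0 * DIM('a) + d P0 \<bullet> d P0))"
      unfolding \<rho>_def by (rule lin_op_perturb[OF q psd A])
    finally have "R P \<le> lin_op (A P0) (d P0) q z"
      using A \<rho>_nonneg[of P] unfolding R_def by (simp add: pos_divide_le_eq add_pos_nonneg mult.commute diff_le_eq)
    moreover have "dist P P0 < e"
    proof -
      have "dist P P0 = k * norm ((y - y1) - (z - z0))"
        using c by (simp add: P_def P0 k_def dist_norm flip: scaleR_diff_right) (simp add: algebra_simps)
      also have "\<dots> \<le> k * (norm (y - y1) + norm (z - z0))"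
        using c by (intro mult_left_mono norm_triangle_ineq4) (simp add: k_def)
      also have "\<dots> < k * (s + s)"
        using yN z c by (intro mult_strict_left_mono add_strict_mono) (auto simp: dist_norm norm_minus_commute r_def k_def)
      also have "\<dots> = e" using c by (simp add: k_def s_def)
      finally show ?thesis .
    qed
    ultimately show "\<gamma>' \<le> lin_op (A P0) (d P0) q z" using e(2)[of P] by simp
  qed
  moreover have "r > 0" using r0 s by (simp add: r_def)
  ultimately show ?thesis by blast
qed

section \<open>Comparison on compact sets\<close>

text \<open>Maximizers of the doubled function with penalties \<open>Suc n\<close> accumulate at a
  point of the diagonal where the sum exceeds \<open>m\<close>, hence at a point of
  \<open>N\<close>. Since \<open>h1\<close> and \<open>h2\<close> are continuous there, their sum is
  still positive at nearby pairs of maximizers.\<close>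

lemma doubling_maximizers:
  fixes K :: "'a::euclidean_space set" and h1 h2 :: "'a \<Rightarrow> real"
  assumes K: "compact K" "usc_on K w1" "usc_on K w2" and N: "open N" "N \<subseteq> K"
    and h: "continuous_on N h1" "continuous_on N h2" "\<And>y. y \<in> N \<Longrightarrow> h1 y + h2 y > 0"
    and bd: "\<And>x. x \<in> K - N \<Longrightarrow> w1 x + w2 x \<le> m"
    and z: "z \<in> K" "w1 z + w2 z > m"
  shows "\<exists>c>0. \<exists>y1\<in>N. \<exists>y2\<in>N. h1 y1 + h2 y2 > 0 \<and>
    (\<forall>x\<in>K. \<forall>y\<in>K. w1 x + w2 y - c * (norm (x - y))\<^sup>2 \<le> w1 y1 + w2 y2 - c * (norm (y1 - y2))\<^sup>2)"
proof -
  let ?s = "\<lambda>p. w1 (fst p) + w2 (snd p)"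
  let ?g = "\<lambda>n p. ?s p + - real (Suc n) * (norm (fst p - snd p))\<^sup>2"
  have K2: "compact (K \<times> K)" "K \<times> K \<noteq> {}" using K z by (auto intro: compact_Times)
  have usc: "usc_on (K \<times> K) ?s"
    by (intro usc_on_add usc_on_compose[OF K(2)] usc_on_compose[OF K(3)] continuous_intros) auto
  have "\<exists>p\<in>K \<times> K. \<forall>x\<in>K \<times> K. ?g n x \<le> ?g n p" for n
    by (intro usc_on_attains_max K2 usc_on_add[OF usc] continuous_imp_usc_on continuous_intros)
  then obtain p where p: "\<And>n. p n \<in> K \<times> K" "\<And>n x. x \<in> K \<times> K \<Longrightarrow> ?g n x \<le> ?g n (p n)"
    by metis
  \<comment> \<open>The competitor is the diagonal point \<open>(z, z)\<close>, where the penalty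
    vanishes.\<close>
  have low: "w1 z + w2 z + real (Suc n) * (norm (fst (p n) - snd (p n)))\<^sup>2 \<le> ?s (p n)" for n
    using p(2)[of "(z, z)" n] z by (simp add: algebra_simps)
  obtain q where q: "q \<in> K \<times> K" "\<And>x. x \<in> K \<times> K \<Longrightarrow> ?s x \<le> ?s q"
    using usc_on_attains_max[OF K2 usc] by blast
  have "compact (K \<times> K)" by fact
  then obtain l r where l: "l \<in> K \<times> K" "strict_mono r" "(p \<circ> r) \<longlonglongrightarrow> l"
    using p(1) unfolding compact_def by blast
  have diag: "fst l = snd l"
  proof -
    have "\<forall>\<^sub>F n in sequentially.
        norm ((norm (fst (p n) - snd (p n)))\<^sup>2) \<le> (?s q - (w1 z + w2 z)) / real (Suc n)"
    proof (rule always_eventually, rule allI)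
      fix n
      have "(norm (fst (p n) - snd (p n)))\<^sup>2 * real (Suc n) \<le> ?s q - (w1 z + w2 z)"
        using low[of n] q(2)[OF p(1), of n] by (simp only: mult.commute)
      then show "norm ((norm (fst (p n) - snd (p n)))\<^sup>2) \<le> (?s q - (w1 z + w2 z)) / real (Suc n)"
        by (simp add: pos_le_divide_eq del: of_nat_Suc)
    qed
    moreover have "(\<lambda>n. (?s q - (w1 z + w2 z)) / real (Suc n)) \<longlonglongrightarrow> 0"
      by (rule LIMSEQ_Suc) (rule lim_const_over_n)
    ultimately have "(\<lambda>n. (norm (fst (p n) - snd (p n)))\<^sup>2) \<longlonglongrightarrow> 0"
      by (rule Lim_null_comparison)
    then have "((\<lambda>n. (norm (fst (p n) - snd (p n)))\<^sup>2) \<circ> r) \<longlonglongrightarrow> 0"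
      using l(2) by (rule LIMSEQ_subseq_LIMSEQ)
    moreover have "((\<lambda>n. (norm (fst (p n) - snd (p n)))\<^sup>2) \<circ> r) \<longlonglongrightarrow> (norm (fst l - snd l))\<^sup>2"
      using tendsto_power[OF tendsto_norm[OF tendsto_diff[OF tendsto_fst[OF l(3)] tendsto_snd[OF l(3)]]], of 2]
      by (simp add: o_def)
    ultimately have "(norm (fst l - snd l))\<^sup>2 = 0" by (rule LIMSEQ_unique[rotated])
    then show ?thesis by simp
  qed
  \<comment> \<open>All values \<open>?s (p n)\<close> are at least \<open>w1 z + w2 z\<close>, and
    upper semicontinuity passes this bound on to the limit point.\<close>
  have "m < ?s l"
  proof (rule ccontr)
    assume "\<not> ?thesis"
    then have "?s l < w1 z + w2 z" using z by simp
    from usc_onD_nhds[OF usc l(1) this]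
    have "\<forall>\<^sub>F n in sequentially. p (r n) \<in> K \<times> K \<longrightarrow> ?s (p (r n)) < w1 z + w2 z"
      using l(3) by (auto intro: eventually_compose_filterlim simp: o_def)
    then obtain n where "?s (p (r n)) < w1 z + w2 z"
      using p(1) by (auto simp: eventually_sequentially)
    moreover have "0 \<le> real (Suc (r n)) * (norm (fst (p (r n)) - snd (p (r n))))\<^sup>2" by simp
    ultimately show False using low[of "r n"] by linarith
  qed
  then have lN: "fst l \<in> N" using bd[of "fst l"] l(1) diag by (cases l) force
  have l1: "(\<lambda>n. fst (p (r n))) \<longlonglongrightarrow> fst l" and l2: "(\<lambda>n. snd (p (r n))) \<longlonglongrightarrow> fst l"
    using tendsto_fst[OF l(3)] tendsto_snd[OF l(3)] diag by (simp_all add: o_def)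
  have cont: "isCont h1 (fst l)" "isCont h2 (fst l)"
    using h(1,2) lN N(1) by (simp_all add: continuous_on_eq_continuous_at)
  have "(\<lambda>n. h1 (fst (p (r n))) + h2 (snd (p (r n)))) \<longlonglongrightarrow> h1 (fst l) + h2 (fst l)"
    by (rule tendsto_add[OF isCont_tendsto_compose[OF cont(1) l1] isCont_tendsto_compose[OF cont(2) l2]])
  then have "\<forall>\<^sub>F n in sequentially. 0 < h1 (fst (p (r n))) + h2 (snd (p (r n)))"
    using h(3)[OF lN] by (rule order_tendstoD(1))
  moreover have "\<forall>\<^sub>F n in sequentially. fst (p (r n)) \<in> N" "\<forall>\<^sub>F n in sequentially. snd (p (r n)) \<in> N"
    using topological_tendstoD[OF l1 N(1) lN] topological_tendstoD[OF l2 N(1) lN] .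
  ultimately have "\<forall>\<^sub>F n in sequentially. 0 < h1 (fst (p (r n))) + h2 (snd (p (r n)))
      \<and> fst (p (r n)) \<in> N \<and> snd (p (r n)) \<in> N"
    by eventually_elim simp
  then obtain n where n: "0 < h1 (fst (p (r n))) + h2 (snd (p (r n)))" "fst (p (r n)) \<in> N" "snd (p (r n)) \<in> N"
    by (auto simp: eventually_sequentially)
  have "\<forall>x\<in>K. \<forall>y\<in>K. w1 x + w2 y - real (Suc (r n)) * (norm (x - y))\<^sup>2
      \<le> w1 (fst (p (r n))) + w2 (snd (p (r n))) - real (Suc (r n)) * (norm (fst (p (r n)) - snd (p (r n))))\<^sup>2"
  proof (intro ballI)
    fix x y assume "x \<in> K" "y \<in> K"
    then show "w1 x + w2 y - real (Suc (r n)) * (norm (x - y))\<^sup>2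
      \<le> w1 (fst (p (r n))) + w2 (snd (p (r n))) - real (Suc (r n)) * (norm (fst (p (r n)) - snd (p (r n))))\<^sup>2"
      using p(2)[of "(x, y)" "r n"] by (simp del: of_nat_Suc)
  qed
  moreover have "real (Suc (r n)) > 0" by simp
  ultimately show ?thesis using n by blast
qed

text \<open>This is the parallelogram identity for \<open>x - z\<close> and \<open>y - z\<close>. It
  splits the penalty of the doubled function into the penalties of two separate
  sup-convolutions.\<close>

lemma midpoint_sqdist:
  fixes x y z :: "'a::real_inner"
  shows "2 * (norm (x - z))\<^sup>2 + 2 * (norm (y - z))\<^sup>2 = (norm (x - y))\<^sup>2 + (norm (x + y - 2 *\<^sub>R z))\<^sup>2"
  by (simp add: power2_norm_eq_inner inner_diff inner_add inner_commute algebra_simps)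

text \<open>The sup-convolution at \<open>z\<close> sees the equation at a shifted point, so the
  right-hand side is first replaced by a constant near the maximizer.\<close>

lemma visc_subsol_const_nhd:
  assumes sub: "visc_subsol A d B h N w" and h: "continuous_on N h" and N: "open N"
    and y: "y \<in> N" "\<gamma> < h y"
  obtains N' where "open N'" "y \<in> N'" "N' \<subseteq> N" "visc_subsol A d B (\<lambda>_. \<gamma>) N' w"
proof
  let ?N' = "N \<inter> h -` {\<gamma><..}"
  show "open ?N'" using continuous_on_open_vimage[OF N] h by (metis open_greaterThan inf_commute)
  show "visc_subsol A d B (\<lambda>_. \<gamma>) ?N' w"
    using sub unfolding visc_subsol_def by (auto 0 3 intro: order_trans less_imp_le)
qed (use y in auto)

lemma lin_op_neg_dir: "rpoly q \<Longrightarrow> lin_op a (- d) q z = lin_op a d q z"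
  using dir_deriv_scale_dir[of _ "-1" d]
  by (simp add: lin_op_def dir_deriv_cmult[of _ _ "-1", simplified] rpoly_dir_deriv)

text \<open>
  The alternative at each gradient covers both the uniformly elliptic case and the degenerate points
  of the \<open>p\<close>-Laplacian, where the positive right-hand side excludes touching from above.
\<close>

theorem visc_subsol_sum_comparison:
  fixes K :: "'a::euclidean_space set"
  assumes A: "\<And>P. A (- P) = A P" and d: "\<And>P. d (- P) = - d P" and B: "\<And>P. B (- P) = - B P"
    and op: "\<And>P. isCont A P \<and> isCont d P \<and> isCont B P \<and> A P > 0 \<or> A P = 0 \<and> d P = 0 \<and> B P = 0"
    and K: "compact K" "usc_on K w1" "usc_on K w2" and N: "open N" "N \<subseteq> K"
    and sub: "visc_subsol A d B h1 N w1" "visc_subsol A d B h2 N w2"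
    and h: "continuous_on N h1" "continuous_on N h2" "\<And>y. y \<in> N \<Longrightarrow> h1 y + h2 y > 0"
      "\<And>y. y \<in> N \<Longrightarrow> h1 y > 0"
    and bd: "\<And>x. x \<in> K - N \<Longrightarrow> w1 x + w2 x \<le> m"
    and z: "z \<in> K"
  shows "w1 z + w2 z \<le> m"
proof (rule ccontr)
  assume "\<not> ?thesis"
  then have "w1 z + w2 z > m" by simp
  from doubling_maximizers[OF K N h(1-3) bd z this]
  obtain c y1 y2 where c: "c > 0" and y: "y1 \<in> N" "y2 \<in> N" "h1 y1 + h2 y2 > 0"
    and max: "\<And>x y. x \<in> K \<Longrightarrow> y \<in> K \<Longrightarrow>
      w1 x + w2 y - c * (norm (x - y))\<^sup>2 \<le> w1 y1 + w2 y2 - c * (norm (y1 - y2))\<^sup>2"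
    by blast
  define M where "M = w1 y1 + w2 y2 - c * (norm (y1 - y2))\<^sup>2"
  define z0 where "z0 = (1/2) *\<^sub>R (y1 + y2)"
  have z0: "y1 + y2 - 2 *\<^sub>R z0 = 0" by (simp add: z0_def)
  have yK: "y1 \<in> K" "y2 \<in> K" using y N by auto
  have ne: "K \<noteq> {}" using z by auto
  have c2: "2 * c > 0" using c by simp
  let ?W1 = "sup_conv (2 * c) K w1" and ?W2 = "sup_conv (2 * c) K w2"
  have split: "w1 x - 2 * c * (norm (x - z))\<^sup>2 + (w2 y - 2 * c * (norm (y - z))\<^sup>2)
      = w1 x + w2 y - c * (norm (x - y))\<^sup>2 - c * (norm (x + y - 2 *\<^sub>R z))\<^sup>2" for x y z
  proof -
    have "c * (2 * (norm (x - z))\<^sup>2 + 2 * (norm (y - z))\<^sup>2)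
        = c * ((norm (x - y))\<^sup>2 + (norm (x + y - 2 *\<^sub>R z))\<^sup>2)"
      unfolding midpoint_sqdist ..
    then show ?thesis by (simp add: algebra_simps)
  qed
  have le: "w1 x - 2 * c * (norm (x - z))\<^sup>2 + (w2 y - 2 * c * (norm (y - z))\<^sup>2) \<le> M"
    if "x \<in> K" "y \<in> K" for x y z
    using max[OF that] c unfolding split M_def
    by (smt (verit) mult_nonneg_nonneg zero_le_power2)
  \<comment> \<open>The sum of the two sup-convolutions never exceeds \<open>M\<close>, and it
    attains \<open>M\<close> at the midpoint \<open>z0\<close>, where the last square in
    \<open>split\<close> vanishes.\<close>
  have W_le: "?W1 x + ?W2 x \<le> M" for x
    using sup_conv_attained(1)[OF K(1) ne K(2), of "2 * c" x]
      sup_conv_attained(1)[OF K(1) ne K(3), of "2 * c" x] le by auto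
  have W_z0: "w1 y1 - 2 * c * (norm (y1 - z0))\<^sup>2 + (w2 y2 - 2 * c * (norm (y2 - z0))\<^sup>2) = M"
    unfolding split z0 by (simp add: M_def)
  have W1_z0: "?W1 z0 = w1 y1 - 2 * c * (norm (y1 - z0))\<^sup>2" and W2_z0: "?W2 z0 = w2 y2 - 2 * c * (norm (y2 - z0))\<^sup>2"
    using W_le[of z0] W_z0 sup_conv_attained(2)[OF K(1) ne K(2) yK(1), of "2 * c" z0]
      sup_conv_attained(2)[OF K(1) ne K(3) yK(2), of "2 * c" z0] by linarith+
  \<comment> \<open>Equality forces that square to vanish. Fixing one point at its maximizer thus
    determines the other.\<close>
  have uniq_aux: "x + y = y1 + y2"
    if "x \<in> K" "y \<in> K" "w1 x - 2 * c * (norm (x - z0))\<^sup>2 + (w2 y - 2 * c * (norm (y - z0))\<^sup>2) = M" for x y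
  proof -
    have "c * (norm (x + y - 2 *\<^sub>R z0))\<^sup>2 \<le> 0"
      using that(3) max[OF that(1,2)] unfolding split M_def by linarith
    then have "(norm (x + y - 2 *\<^sub>R z0))\<^sup>2 \<le> 0" using c by (simp add: mult_le_0_iff)
    then show ?thesis using z0 by simp
  qed
  have uniq1: "x = y1" if "x \<in> K" "?W1 z0 = w1 x - 2 * c * (norm (x - z0))\<^sup>2" for x
    using uniq_aux[of x y2] that yK W1_z0 W_z0 by simp
  have uniq2: "x = y2" if "x \<in> K" "?W2 z0 = w2 x - 2 * c * (norm (x - z0))\<^sup>2" for x
    using uniq_aux[of y1 x] that yK W2_z0 W_z0 by simp
  define P0 where "P0 = (2 * (2 * c)) *\<^sub>R (y1 - z0)"
  \<comment> \<open>Since \<open>z0\<close> is the midpoint, the gradients of the two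
    sup-convolutions at \<open>z0\<close> are opposite.\<close>
  have P0': "- P0 = (2 * (2 * c)) *\<^sub>R (y2 - z0)"
    using z0 by (simp add: P0_def z0_def algebra_simps flip: scaleR_add_left)
  \<comment> \<open>The paraboloid \<open>?q\<close> touches \<open>w1\<close> from above at
    \<open>y1\<close> with gradient \<open>P0\<close>. If the coefficients vanished at
    \<open>P0\<close>, the subsolution property would give \<open>h1 y1 \<le> 0\<close>.\<close>
  have nondeg: "A P0 > 0 \<and> isCont A P0 \<and> isCont d P0 \<and> isCont B P0"
  proof (rule ccontr)
    assume "\<not> ?thesis"
    then have deg: "A P0 = 0" "d P0 = 0" "B P0 = 0" using op[of P0] by auto
    let ?q = "\<lambda>x. 2 * c * (norm (x - z0))\<^sup>2"
    have q: "rpoly ?q" by (intro rpoly_mult rpoly_const rpoly_sqdist)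
    have grad: "grad ?q y1 = P0"
      by (rule grad_eqI[OF q], simp only: dir_deriv_cmult[OF rpoly_sqdist] dir_deriv_sqdist) (simp add: P0_def)
    have "\<forall>\<^sub>F x in nhds y1. x \<in> N" using N y by (simp add: eventually_nhds_in_open)
    then have "\<forall>\<^sub>F x in nhds y1. w1 x - ?q x \<le> w1 y1 - ?q y1"
    proof eventually_elim
      case (elim x)
      then show ?case using sup_conv_attained(2)[OF K(1) ne K(2), of x "2 * c" z0] N W1_z0 by auto
    qed
    then have "h1 y1 \<le> quasi_op A d B ?q y1" using sub(1) q y(1) unfolding visc_subsol_def by blast
    also have "\<dots> = 0" unfolding quasi_op_def grad deg lin_op_def
      using dir_deriv_scale_dir[OF rpoly_dir_deriv[OF q], of 0 0] by simp
    finally show False using h(4)[OF y(1)] by simp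
  qed
  \<comment> \<open>Each right-hand side gives up \<open>3/2 * \<eta>\<close>: one
    \<open>\<eta>\<close> for freezing it and half of one for the strict inequality in
    \<open>sup_conv_lin_subsol\<close>. A quarter of \<open>h1 y1 + h2 y2\<close> remains.\<close>
  define \<eta> where "\<eta> = (h1 y1 + h2 y2) / 4"
  have \<eta>: "\<eta> > 0" using y by (simp add: \<eta>_def)
  obtain N1 where N1: "open N1" "y1 \<in> N1" "N1 \<subseteq> N" "visc_subsol A d B (\<lambda>_. h1 y1 - \<eta>) N1 w1"
    using visc_subsol_const_nhd[OF sub(1) h(1) N(1) y(1), of "h1 y1 - \<eta>"] \<eta> by auto
  obtain N2 where N2: "open N2" "y2 \<in> N2" "N2 \<subseteq> N" "visc_subsol A d B (\<lambda>_. h2 y2 - \<eta>) N2 w2"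
    using visc_subsol_const_nhd[OF sub(2) h(2) N(1) y(2), of "h2 y2 - \<eta>"] \<eta> by auto
  obtain r1 where r1: "r1 > 0" "lin_subsol (A P0) (d P0) (h1 y1 - 3/2 * \<eta> - B P0) (ball z0 r1) ?W1"
    using sup_conv_lin_subsol[OF K(1,2) c2 N1(1) _ N1(2,4) uniq1 P0_def, of "h1 y1 - 3/2 * \<eta> - B P0"]
      nondeg N1 N \<eta> by auto
  have cont': "isCont A (- P0)" "isCont d (- P0)" "isCont B (- P0)" "A (- P0) > 0"
    using nondeg op[of "- P0"] A[of P0] by auto
  obtain r2 where r2: "r2 > 0" "lin_subsol (A (- P0)) (d (- P0)) (h2 y2 - 3/2 * \<eta> + B P0) (ball z0 r2) ?W2"
    using sup_conv_lin_subsol[OF K(1,3) c2 N2(1) _ N2(2,4) uniq2 P0' cont', of "h2 y2 - 3/2 * \<eta> + B P0"]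
      N2 N \<eta> B[of P0] by auto
  \<comment> \<open>The direction enters the operator quadratically, so freezing at
    \<open>P0\<close> or at \<open>- P0\<close> gives the same linear operator.\<close>
  have r2': "lin_subsol (A P0) (d P0) (h2 y2 - 3/2 * \<eta> + B P0) (ball z0 r2) ?W2"
    using r2(2) unfolding lin_subsol_def A d by (simp add: lin_op_neg_dir)
  define r where "r = min r1 r2"
  have sub_r: "lin_subsol a e s (ball z0 r) W" if "lin_subsol a e s (ball z0 r') W" "r \<le> r'" for a e s r' W
    using that unfolding lin_subsol_def by auto
  show False
  proof (rule lin_subsol_sum_no_max)
    show "A P0 > 0" using nondeg by simp
    show "r > 0" using r1 r2 by (simp add: r_def)
    show "continuous_on (cball z0 r) ?W1" "continuous_on (cball z0 r) ?W2"
      by (intro continuous_at_imp_continuous_on ballI isCont_sup_conv K ne c2)+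
    show "lin_subsol (A P0) (d P0) (h1 y1 - 3/2 * \<eta> - B P0) (ball z0 r) ?W1"
      by (rule sub_r[OF r1(2)]) (simp add: r_def)
    show "lin_subsol (A P0) (d P0) (h2 y2 - 3/2 * \<eta> + B P0) (ball z0 r) ?W2"
      by (rule sub_r[OF r2']) (simp add: r_def)
    show "h1 y1 - 3/2 * \<eta> - B P0 + (h2 y2 - 3/2 * \<eta> + B P0) > 0"
      using y(3) by (simp add: \<eta>_def field_simps)
    show "?W1 x + ?W2 x \<le> ?W1 z0 + ?W2 z0" for x
      using W_le[of x] W1_z0 W2_z0 W_z0 by simp
  qed
qed

section \<open>The cone-degenerate operator in logarithmic coordinates\<close>

primrec cone_axis :: "'m option \<Rightarrow> real \<times> (real ^ 'm::finite)" where
  "cone_axis None = (1, 0)"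
| "cone_axis (Some i) = (0, axis i 1)"

lemma bij_betw_cone_axis: "bij_betw cone_axis (UNIV :: 'm::finite option set) Basis"
proof (rule bij_betwI')
  show "(cone_axis i = cone_axis j) = (i = j)" for i j :: "'m option"
    by (cases i; cases j) (auto simp: axis_eq_axis zero_prod_def)
  show "cone_axis i \<in> Basis" for i :: "'m option"
    by (cases i) (auto simp: Basis_prod_def Basis_vec_def)
  show "\<exists>i\<in>UNIV. b = cone_axis i" if "b \<in> Basis" for b :: "real \<times> (real ^ 'm)"
  proof -
    consider "b = (1, 0)" | i where "b = (0, axis i 1)"
      using \<open>b \<in> Basis\<close> by (auto simp: Basis_prod_def Basis_vec_def)
    then show ?thesis
    proof cases
      case 1
      then show ?thesis by (intro bexI[of _ None]) auto
    next
      case 2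
      then show ?thesis by (intro bexI[of _ "Some i"]) auto
    qed
  qed
qed

lemma sum_cone_axis: "(\<Sum>i\<in>UNIV. F (cone_axis i)) = (\<Sum>b\<in>Basis. F b)"
  by (rule sum.reindex_bij_betw[OF bij_betw_cone_axis])

text \<open>The case \<open>p = 2\<close> is separate because \<open>0 powr 0 = 0\<close>, while the
  coefficient of the Laplacian must be 1 even at zero gradient.\<close>

definition plap_coeff :: "real \<Rightarrow> 'a::real_normed_vector \<Rightarrow> real" where
  "plap_coeff p P = (if p = 2 then 1 else norm P powr (p - 2))"

text \<open>The second derivative in this direction is \<open>(p - 2) * norm P powr (p - 4)\<close>
  times the Hessian form at \<open>P\<close>. For \<open>p = 2\<close> the square root makes it
  vanish.\<close>

definition plap_dir :: "real \<Rightarrow> 'a::real_normed_vector \<Rightarrow> 'a" where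
  "plap_dir p P = (sqrt (p - 2) * norm P powr ((p - 4) / 2)) *\<^sub>R P"

definition plap_drift :: "real \<Rightarrow> real \<times> (real ^ 'm::finite) \<Rightarrow> real" where
  "plap_drift p P = (real CARD('m option) - p) * plap_coeff p P * fst P"

lemma plap_coeff_scale: "k > 0 \<Longrightarrow> plap_coeff p (k *\<^sub>R P) = k powr (p - 2) * plap_coeff p P"
  by (simp add: plap_coeff_def powr_mult)

lemma plap_drift_scale: "k > 0 \<Longrightarrow> plap_drift p (k *\<^sub>R P) = k powr (p - 1) * plap_drift p P"
proof -
  assume k: "k > 0"
  have "k powr (p - 1) = k powr (p - 2) * k" using k powr_add[of k "p - 2" 1] by simp
  then show ?thesis by (simp add: plap_drift_def plap_coeff_scale k)
qed

lemma plap_dir_scale: "k > 0 \<Longrightarrow> plap_dir p (k *\<^sub>R P) = k powr ((p - 2) / 2) *\<^sub>R plap_dir p P"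
proof -
  assume k: "k > 0"
  have "k powr ((p - 2) / 2) = k powr ((p - 4) / 2) * k"
    using k powr_add[of k "(p - 4) / 2" 1] by (simp add: field_simps)
  then show ?thesis using k by (simp add: plap_dir_def powr_mult)
qed

lemma plap_minus:
  "plap_coeff p (- P) = plap_coeff p P" "plap_dir p (- Q) = - plap_dir p Q"
  "plap_drift p (- R) = - plap_drift p R"
  by (simp_all add: plap_coeff_def plap_dir_def plap_drift_def)

text \<open>For \<open>p = 2\<close> the coefficients are constant and the drift is linear.
  Otherwise the only exceptional gradient is zero, where all three expressions vanish.\<close>

lemma plap_regular_or_degenerate:
  assumes "p \<ge> 2"
  shows "isCont (plap_coeff p) P \<and> isCont (plap_dir p) P \<and> isCont (plap_drift p) P \<and> plap_coeff p P > 0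
    \<or> plap_coeff p P = 0 \<and> plap_dir p P = 0 \<and> plap_drift p P = 0"
proof (cases "p = 2")
  case True
  then show ?thesis
    by (auto simp: plap_coeff_def[abs_def] plap_dir_def[abs_def] plap_drift_def[abs_def] intro!: continuous_intros)
next
  case False
  then show ?thesis
    by (cases "P = 0")
      (auto simp: plap_coeff_def[abs_def] plap_dir_def[abs_def] plap_drift_def[abs_def] intro!: continuous_intros)
qed

definition cone_plap :: "real \<Rightarrow> (real \<times> (real ^ 'm::finite) \<Rightarrow> real) \<Rightarrow> real \<times> (real ^ 'm) \<Rightarrow> real" where
  "cone_plap p = quasi_op (plap_coeff p) (plap_dir p) (plap_drift p)"

lemma grad_cmult: "rpoly q \<Longrightarrow> grad (\<lambda>x. k * q x) z = k *\<^sub>R grad q z"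
  by (simp add: grad_def dir_deriv_cmult scaleR_sum_right)

lemma lin_op_scale_dir:
  assumes "rpoly q"
  shows "lin_op a (k *\<^sub>R d) q z = a * laplacian q z + k\<^sup>2 * dir_deriv d (dir_deriv d q) z"
  by (simp add: lin_op_def dir_deriv_scale_dir dir_deriv_cmult rpoly_dir_deriv assms power2_eq_square)

text \<open>This homogeneity is the source of strictness: scaling a subsolution by
  \<open>k > 1\<close> multiplies its positive right-hand side by a factor above 1.\<close>

lemma cone_plap_scale:
  assumes q: "rpoly q" and k: "k > 0"
  shows "cone_plap p (\<lambda>x. k * q x) z = k powr (p - 1) * cone_plap p q z"
proof -
  have "(k powr ((p - 2) / 2))\<^sup>2 = k powr (p - 2)"
    using k by (simp add: power2_eq_square flip: powr_add)
  moreover have "k powr (p - 1) = k powr (p - 2) * k" using k powr_add[of k "p - 2" 1] by simp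
  ultimately show ?thesis
    unfolding cone_plap_def quasi_op_def grad_cmult[OF q] plap_coeff_scale[OF k] plap_dir_scale[OF k]
      plap_drift_scale[OF k] lin_op_cmult[OF q] lin_op_scale_dir[OF q]
    by (simp add: lin_op_def algebra_simps)
qed

lemma cone_plap_uminus:
  assumes q: "rpoly q" shows "cone_plap p (\<lambda>x. - q x) z = - cone_plap p q z"
proof -
  have g: "grad (\<lambda>x. - q x) z = - grad q z" using grad_cmult[OF q, of "-1"] by simp
  have "lin_op a (- d) q z = lin_op a d q z" for a d
    using lin_op_scale_dir[OF q, of a "-1" d z] by (simp add: lin_op_def)
  then show ?thesis
    unfolding cone_plap_def quasi_op_def g plap_minus lin_op_uminus[OF q] by simp
qed

text \<open>The vectors \<open>cone_axis i\<close> enumerate the orthonormal basis, so norm, trace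
  and quadratic form agree with their coordinate-free versions. At zero gradient
  \<open>pLap_0\<close> supplies the continuous extension.\<close>

lemma pLap_eq_cone_plap:
  fixes q :: "real \<times> (real ^ 'm::finite) \<Rightarrow> real"
  assumes p: "p \<ge> 2" and q: "rpoly q"
  shows "pLap p (\<chi> i. dir_deriv (cone_axis i) q z)
    (\<chi> i j. dir_deriv (cone_axis i) (dir_deriv (cone_axis j) q) z) = cone_plap p q z"
    (is "pLap p ?P ?A = _")
proof -
  define G where "G = grad q z"
  have P: "?P $ i = G \<bullet> cone_axis i" for i
    using dir_deriv_eq_grad[OF q] by (simp add: G_def)
  have "?P \<bullet> ?P = (\<Sum>i\<in>UNIV. (G \<bullet> cone_axis i) * (G \<bullet> cone_axis i))"
    unfolding inner_vec_def P by simp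
  also have "\<dots> = G \<bullet> G"
    by (subst sum_cone_axis[of "\<lambda>b. (G \<bullet> b) * (G \<bullet> b)"]) (rule euclidean_inner[symmetric])
  finally have norm: "norm ?P = norm G" by (simp add: norm_eq_sqrt_inner)
  have trace: "trace ?A = laplacian q z"
    unfolding trace_def laplacian_def by (simp add: sum_cone_axis[of "\<lambda>b. dir_deriv b (dir_deriv b q) z"])
  define H where "H = (\<lambda>v w. dir_deriv v (dir_deriv w q) z)"
  have bil: "bilinear H" using bilinear_hessian[OF q, of z 0] by (simp add: H_def)
  have "(?A *v ?P) \<bullet> ?P = (\<Sum>i\<in>UNIV. \<Sum>j\<in>UNIV. (G \<bullet> cone_axis i) * ((G \<bullet> cone_axis j) * H (cone_axis i) (cone_axis j)))"
    unfolding inner_vec_def matrix_vector_mult_def P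
    by (simp add: H_def sum_distrib_left sum_distrib_right P[simplified] mult_ac)
  also have "\<dots> = (\<Sum>b\<in>Basis. \<Sum>c\<in>Basis. (G \<bullet> b) * ((G \<bullet> c) * H b c))"
    by (simp add: sum_cone_axis[of "\<lambda>c. (G \<bullet> _) * ((G \<bullet> c) * H _ c)"]
        sum_cone_axis[of "\<lambda>b. \<Sum>c\<in>Basis. (G \<bullet> b) * ((G \<bullet> c) * H b c)"])
  also have "\<dots> = H (\<Sum>b\<in>Basis. (G \<bullet> b) *\<^sub>R b) (\<Sum>b\<in>Basis. (G \<bullet> b) *\<^sub>R b)"
    by (simp add: bilinear_sum[OF bil] bilinear_lmul[OF bil] bilinear_rmul[OF bil] sum.cartesian_product
        mult.left_commute)
  finally have quad: "(?A *v ?P) \<bullet> ?P = H G G" by (simp add: euclidean_representation)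
  have None: "?P $ None = fst G" unfolding P by (cases G) simp
  have zero: "?P = 0 \<longleftrightarrow> G = 0" using norm by (metis norm_eq_zero)
  have cone: "cone_plap p q z = plap_coeff p G * laplacian q z
      + (sqrt (p - 2) * norm G powr ((p - 4) / 2))\<^sup>2 * H G G
      + (real CARD('m option) - p) * plap_coeff p G * fst G"
    unfolding cone_plap_def quasi_op_def G_def[symmetric] plap_dir_def lin_op_scale_dir[OF q]
    by (simp add: H_def plap_drift_def)
  show ?thesis
  proof (cases "G = 0")
    case True
    then show ?thesis unfolding cone using zero trace p by (simp add: pLap_0 plap_coeff_def)
  next
    case False
    have "(norm G powr ((p - 4) / 2))\<^sup>2 = norm G powr (p - 4)"
      by (simp add: power2_eq_square flip: powr_add)
    then show ?thesis unfolding cone pLap_def pLap_nz_def norm trace quad None zero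
      using False p by (simp add: plap_coeff_def power_mult_distrib)
  qed
qed

section \<open>Passage between the cone and logarithmic coordinates\<close>

definition log_coord :: "real \<times> 'a \<Rightarrow> real \<times> 'a" where
  "log_coord z = (ln (fst z), snd z)"

lemma log_coord_has_derivative:
  assumes "rpoly q" "fst z > 0"
  shows "((\<lambda>z. q (log_coord z)) has_derivative
    (\<lambda>h. dir_deriv (fst h / fst z, snd h) q (log_coord z))) (at z)"
proof -
  have "(log_coord has_derivative (\<lambda>h. (fst h / fst z, snd h))) (at z)"
    unfolding log_coord_def[abs_def] using assms(2)
    by (auto intro!: derivative_eq_intros simp: divide_inverse)
  from has_derivative_compose[OF this rpoly_has_derivative[OF assms(1)]]
  show ?thesis .
qed

lemma open_right_half: "open {z :: real \<times> 'a::topological_space. fst z > 0}"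
  by (intro open_Collect_less continuous_intros)

text \<open>The factor \<open>t\<close> in \<open>D_B None\<close> cancels the derivative
  \<open>1 / t\<close> of the logarithm. Agreement of \<open>\<psi>\<close> is asked only for
  positive \<open>t\<close>, so that the rule applies again to first derivatives when the Hessian is
  computed.\<close>

lemma D_B_log_coord:
  fixes q :: "real \<times> (real ^ 'm::finite) \<Rightarrow> real"
  assumes q: "rpoly q" and \<psi>: "\<And>z. fst z > 0 \<Longrightarrow> \<psi> z = q (log_coord z)" and z: "fst z > 0"
  shows "D_B i \<psi> z = dir_deriv (cone_axis i) q (log_coord z)"
proof -
  have "(\<psi> has_derivative (\<lambda>h. dir_deriv (fst h / fst z, snd h) q (log_coord z))) (at z)"
    by (rule has_derivative_transform_within_open[OF log_coord_has_derivative[OF q z] open_right_half])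
      (use z \<psi> in auto)
  from frechet_derivative_at[OF this, symmetric]
  have fd: "frechet_derivative \<psi> (at z) = (\<lambda>h. dir_deriv (fst h / fst z, snd h) q (log_coord z))" .
  show ?thesis
  proof (cases i)
    case None
    have "dir_deriv (1 / fst z, 0) q = (\<lambda>x. 1 / fst z * dir_deriv (1, 0) q x)"
      using dir_deriv_scale_dir[OF q, of "1 / fst z" "(1, 0)"] by simp
    then show ?thesis using None z by (simp add: fd)
  qed (simp add: fd)
qed

lemma grad_B_log_coord:
  assumes "rpoly q" "fst z > 0"
  shows "grad_B (\<lambda>z. q (log_coord z)) z = (\<chi> i. dir_deriv (cone_axis i) q (log_coord z))"
  unfolding grad_B_def using D_B_log_coord[OF assms(1) refl assms(2)] by simp

lemma hess_B_log_coord: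
  assumes "rpoly q" "fst z > 0"
  shows "hess_B (\<lambda>z. q (log_coord z)) z
    = (\<chi> i j. dir_deriv (cone_axis i) (dir_deriv (cone_axis j) q) (log_coord z))"
  unfolding hess_B_def
  using D_B_log_coord[OF rpoly_dir_deriv[OF assms(1)] D_B_log_coord[OF assms(1) refl] assms(2)] by simp

text \<open>The powers of \<open>1 / t\<close> make the class closed under differentiation: the
  \<open>t\<close>-derivative replaces \<open>k\<close> by \<open>k + 1\<close> and \<open>q\<close>
  by its first partial derivative minus \<open>k\<close> times \<open>q\<close>.\<close>

lemma Ck_on_log_coord:
  fixes q :: "real \<times> (real ^ 'm::finite) \<Rightarrow> real"
  assumes "rpoly q" "open S" "S \<subseteq> {z. fst z > 0}"
    and "\<And>z. z \<in> S \<Longrightarrow> \<psi> z = inverse (fst z) ^ k * q (log_coord z)"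
  shows "Ck_on m S \<psi>"
  using assms
proof (induction m arbitrary: \<psi> k q)
  case (0 \<psi> k q)
  have "continuous_on S (\<lambda>z. q (log_coord z))"
  proof (rule continuous_at_imp_continuous_on, rule ballI)
    fix z assume "z \<in> S"
    with 0 have "fst z > 0" by auto
    from has_derivative_continuous[OF log_coord_has_derivative[OF 0(1) this]]
    show "isCont (\<lambda>z. q (log_coord z)) z" .
  qed
  then have "continuous_on S (\<lambda>z. inverse (fst z) ^ k * q (log_coord z))"
    using 0(3) by (intro continuous_intros) auto
  then show ?case using 0(4) by (simp cong: continuous_on_cong)
next
  case (Suc m \<psi> k q)
  have D: "(\<psi> has_derivative (\<lambda>h. inverse (fst z) ^ k * dir_deriv (fst h / fst z, snd h) q (log_coord z)
      + fst h * (- real k * inverse (fst z) ^ Suc k) * q (log_coord z))) (at z)" if z: "z \<in> S" for z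
  proof -
    have pos: "fst z > 0" using z Suc.prems(3) by auto
    have "((\<lambda>t. inverse t ^ k) has_real_derivative (- real k * inverse (fst z) ^ Suc k)) (at (fst z))"
    proof (cases k)
      case (Suc n)
      show ?thesis
        using DERIV_power_Suc[OF DERIV_inverse[of "fst z" UNIV], of n] pos unfolding Suc
        by (simp add: power_Suc algebra_simps)
    qed simp
    from has_derivative_compose[OF has_derivative_fst[OF has_derivative_ident] this[unfolded has_field_derivative_def]]
    have "((\<lambda>z. inverse (fst z) ^ k) has_derivative (\<lambda>h. fst h * (- real k * inverse (fst z) ^ Suc k))) (at z)"
      by (simp add: mult.commute)
    from has_derivative_mult[OF this log_coord_has_derivative[OF Suc.prems(1) pos]]
    show ?thesis
      by (rule has_derivative_transform_within_open[OF _ Suc.prems(2) z]) (simp add: Suc.prems(4))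
  qed
  show ?case unfolding Ck_on.simps
  proof (intro conjI ballI)
    show "\<psi> differentiable at z" if "z \<in> S" for z
      using D[OF that] by (auto simp: differentiable_def)
    fix b :: "real \<times> (real ^ 'm)" assume b: "b \<in> Basis"
    have fd: "frechet_derivative \<psi> (at z) b = inverse (fst z) ^ k * dir_deriv (fst b / fst z, snd b) q (log_coord z)
      + fst b * (- real k * inverse (fst z) ^ Suc k) * q (log_coord z)" if "z \<in> S" for z
      using fun_cong[OF frechet_derivative_at[OF D[OF that]], of b, symmetric] .
    consider "b = (1, 0)" | u where "b = (0, u)" using b by (auto simp: Basis_prod_def)
    then show "Ck_on m S (\<lambda>z. frechet_derivative \<psi> (at z) b)"
    proof cases
      case 1
      show ?thesis
      proof (rule Suc.IH[where k = "Suc k" and q = "\<lambda>x. dir_deriv (1, 0) q x - real k * q x", OF _ Suc.prems(2,3)])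
        show "rpoly (\<lambda>x. dir_deriv (1, 0) q x - real k * q x)"
          by (intro real_polynomial_function_diff rpoly_dir_deriv rpoly_mult rpoly_const Suc.prems)
        fix z assume z: "z \<in> S"
        have "dir_deriv (1 / fst z, 0) q = (\<lambda>x. 1 / fst z * dir_deriv (1, 0) q x)"
          using dir_deriv_scale_dir[OF Suc.prems(1), of "1 / fst z" "(1, 0)"] by simp
        then show "frechet_derivative \<psi> (at z) b
            = inverse (fst z) ^ Suc k * (dir_deriv (1, 0) q (log_coord z) - real k * q (log_coord z))"
          using fd[OF z] by (simp add: 1 divide_inverse algebra_simps)
      qed
    next
      case 2
      show ?thesis
      proof (rule Suc.IH[where k = k and q = "dir_deriv b q", OF _ Suc.prems(2,3)])
        show "rpoly (dir_deriv b q)" by (intro rpoly_dir_deriv Suc.prems)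
        show "frechet_derivative \<psi> (at z) b = inverse (fst z) ^ k * dir_deriv b q (log_coord z)"
          if "z \<in> S" for z using fd[OF that] by (simp add: 2)
      qed
    qed
  qed
qed

lemma Ck_on_cone_dom_log_coord:
  fixes q :: "real \<times> (real ^ 'm::finite) \<Rightarrow> real"
  assumes "rpoly q" "open X" shows "Ck_on m (cone_dom X) (\<lambda>z. q (log_coord z))"
  by (rule Ck_on_log_coord[OF assms(1), where k = 0])
    (use assms(2) in \<open>auto simp: cone_dom_def open_Times\<close>)

definition exp_coord :: "real \<times> 'a \<Rightarrow> real \<times> 'a" where
  "exp_coord z = (exp (fst z), snd z)"

lemma log_exp_coord [simp]: "log_coord (exp_coord z) = z"
  by (simp add: log_coord_def exp_coord_def)

lemma exp_log_coord: "fst z > 0 \<Longrightarrow> exp_coord (log_coord z) = z"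
  by (simp add: log_coord_def exp_coord_def)

lemma fst_exp_coord [simp]: "fst (exp_coord z) = exp (fst z)"
  by (simp add: exp_coord_def)

lemma continuous_on_exp_coord: "continuous_on S (exp_coord :: real \<times> 'a::topological_space \<Rightarrow> _)"
  unfolding exp_coord_def[abs_def] by (intro continuous_intros)

lemma exp_coord_in_cone_dom:
  "exp_coord z \<in> cone_dom X \<longleftrightarrow> z \<in> {..<0} \<times> X"
  by (cases z) (simp add: exp_coord_def cone_dom_def)

lemma eventually_log_coord:
  fixes z :: "real \<times> (real ^ 'm::finite)"
  assumes "\<forall>\<^sub>F y in nhds z. Q y"
  shows "\<forall>\<^sub>F y in at (exp_coord z) within cone_dom X. exp_coord (log_coord y) = y \<and> Q (log_coord y)"
proof -
  have "(log_coord \<longlongrightarrow> (ln (fst (exp_coord z)), snd (exp_coord z))) (at (exp_coord z) within cone_dom X)"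
    unfolding log_coord_def[abs_def] by (intro tendsto_intros) auto
  then have "(log_coord \<longlongrightarrow> z) (at (exp_coord z) within cone_dom X)"
    by (simp add: exp_coord_def)
  from eventually_compose_filterlim[OF assms this]
  have "\<forall>\<^sub>F y in at (exp_coord z) within cone_dom X. Q (log_coord y)" .
  moreover have "\<forall>\<^sub>F y in at (exp_coord z) within cone_dom X. y \<in> cone_dom X"
    by (simp add: eventually_at_filter)
  ultimately show ?thesis
    by eventually_elim (auto simp: cone_dom_def exp_log_coord)
qed

lemma F_op_log_coord:
  assumes "p \<ge> 2" "rpoly q"
  shows "F_op p f (exp_coord z) (grad_B (\<lambda>z. q (log_coord z)) (exp_coord z))
      (hess_B (\<lambda>z. q (log_coord z)) (exp_coord z))
    = exp (fst z) powr (- p) * cone_plap p q z - f (exp_coord z)"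
  unfolding F_op_def by (simp add: grad_B_log_coord hess_B_log_coord assms pLap_eq_cone_plap)

text \<open>A test function \<open>q\<close> for \<open>k * u\<close> corresponds to
  \<open>q / k\<close> for \<open>u\<close>. Homogeneity turns the factor into
  \<open>k powr (p - 1)\<close>, and the weight \<open>t powr (- p)\<close> moves to the right-hand
  side.\<close>

lemma viscosity_subsolution_log_coord:
  fixes X :: "(real ^ 'm::finite) set"
  assumes sub: "viscosity_subsolution X p f u" and p: "p \<ge> 2" and X: "open X" and k: "k > 0"
    and N: "N \<subseteq> {..<0} \<times> X"
  shows "visc_subsol (plap_coeff p) (plap_dir p) (plap_drift p)
    (\<lambda>z. k powr (p - 1) * (exp (fst z) powr p * f (exp_coord z))) N (\<lambda>z. k * u (exp_coord z))"
  unfolding visc_subsol_def cone_plap_def[symmetric]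
proof (intro allI impI, elim conjE)
  fix q z assume q: "rpoly q" and z: "z \<in> N"
    and max: "\<forall>\<^sub>F y in nhds z. k * u (exp_coord y) - q y \<le> k * u (exp_coord z) - q z"
  let ?q = "\<lambda>z. inverse k * q z"
  have q': "rpoly ?q" by (intro rpoly_mult rpoly_const q)
  have dom: "exp_coord z \<in> cone_dom X" using N z exp_coord_in_cone_dom by blast
  have "\<forall>\<^sub>F y in at (exp_coord z) within cone_dom X.
      u y - ?q (log_coord y) \<le> u (exp_coord z) - ?q (log_coord (exp_coord z))"
    using eventually_log_coord[OF max, of X]
  proof eventually_elim
    case (elim y)
    then have "inverse k * (k * u y - q (log_coord y)) \<le> inverse k * (k * u (exp_coord z) - q z)"
      using k by (intro mult_left_mono) auto
    then show ?case using k by (simp add: right_diff_distrib flip: mult.assoc)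
  qed
  then have "0 \<le> F_op p f (exp_coord z) (grad_B (\<lambda>z. ?q (log_coord z)) (exp_coord z))
      (hess_B (\<lambda>z. ?q (log_coord z)) (exp_coord z))"
    using sub dom Ck_on_cone_dom_log_coord[OF q' X, of 2] unfolding viscosity_subsolution_def by blast
  then have "f (exp_coord z) \<le> exp (fst z) powr (- p) * (inverse k powr (p - 1) * cone_plap p q z)"
    unfolding F_op_log_coord[OF p q'] by (simp add: cone_plap_scale q k)
  also have "\<dots> = cone_plap p q z / (exp (fst z) powr p * k powr (p - 1))"
    using k by (simp add: powr_minus inverse_powr divide_inverse)
  finally show "k powr (p - 1) * (exp (fst z) powr p * f (exp_coord z)) \<le> cone_plap p q z"
    using k by (simp add: pos_le_divide_eq mult_ac)
qed

text \<open>The operator is odd, so negating the supersolution and its test functions gives a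
  subsolution with the negated right-hand side.\<close>

lemma viscosity_supersolution_log_coord:
  fixes X :: "(real ^ 'm::finite) set"
  assumes super: "viscosity_supersolution X p f v" and p: "p \<ge> 2" and X: "open X"
    and N: "N \<subseteq> {..<0} \<times> X"
  shows "visc_subsol (plap_coeff p) (plap_dir p) (plap_drift p)
    (\<lambda>z. - (exp (fst z) powr p * f (exp_coord z))) N (\<lambda>z. - v (exp_coord z))"
  unfolding visc_subsol_def cone_plap_def[symmetric]
proof (intro allI impI, elim conjE)
  fix q z assume q: "rpoly q" and z: "z \<in> N"
    and max: "\<forall>\<^sub>F y in nhds z. - v (exp_coord y) - q y \<le> - v (exp_coord z) - q z"
  let ?q = "\<lambda>z. - q z"
  have q': "rpoly ?q" by (intro real_polynomial_function_minus q)
  have dom: "exp_coord z \<in> cone_dom X" using N z exp_coord_in_cone_dom by blast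
  have "\<forall>\<^sub>F y in at (exp_coord z) within cone_dom X.
      v y - ?q (log_coord y) \<ge> v (exp_coord z) - ?q (log_coord (exp_coord z))"
    using eventually_log_coord[OF max, of X] by eventually_elim auto
  then have "0 \<ge> F_op p f (exp_coord z) (grad_B (\<lambda>z. ?q (log_coord z)) (exp_coord z))
      (hess_B (\<lambda>z. ?q (log_coord z)) (exp_coord z))"
    using super dom Ck_on_cone_dom_log_coord[OF q' X, of 2] unfolding viscosity_supersolution_def by blast
  then have "exp (fst z) powr (- p) * (- cone_plap p q z) \<le> f (exp_coord z)"
    unfolding F_op_log_coord[OF p q'] by (simp add: cone_plap_uminus q)
  then show "- (exp (fst z) powr p * f (exp_coord z)) \<le> cone_plap p q z"
    by (simp add: powr_minus field_simps)
qed

section \<open>Behaviour near \<open>t = 0\<close> and the comparison principle on the cone\<close>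

lemma cone_closure_eq: "open X \<Longrightarrow> cone_closure X = {0<..1} \<times> closure X"
  unfolding cone_closure_def cone_dom_def cone_boundary_def
  using closure_Un_frontier[of X] by (auto simp: less_eq_real_def)

lemma has_upper_limit_t0D:
  assumes "has_upper_limit_t0 X u L" "L < a"
  shows "\<exists>r>0. \<forall>z\<in>cone_closure X. fst z < r \<longrightarrow> u z < a"
proof -
  have "\<forall>\<^sub>F r in at_right 0. (SUP z\<in>{z\<in>cone_closure X. 0 < fst z \<and> fst z < r}. ereal (u z)) < ereal a"
    using assms unfolding has_upper_limit_t0_def by (intro order_tendstoD(2)) auto
  then obtain b where b: "b > 0"
    "\<And>r. 0 < r \<Longrightarrow> r < b \<Longrightarrow> (SUP z\<in>{z\<in>cone_closure X. 0 < fst z \<and> fst z < r}. ereal (u z)) < ereal a"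
    unfolding eventually_at_right_field by blast
  have "u z < a" if z: "z \<in> cone_closure X" "fst z < b / 2" for z
  proof -
    have "fst z > 0" using z(1) by (auto simp: cone_closure_def cone_dom_def cone_boundary_def)
    then have "ereal (u z) \<le> (SUP z\<in>{z\<in>cone_closure X. 0 < fst z \<and> fst z < b / 2}. ereal (u z))"
      using z by (intro SUP_upper) auto
    also have "\<dots> < ereal a" by (rule b(2)) (use b(1) in simp_all)
    finally show ?thesis by simp
  qed
  then show ?thesis using b(1) by (intro exI[of _ "b / 2"]) auto
qed

lemma has_lower_limit_t0D:
  assumes "has_lower_limit_t0 X v M" "a < M"
  shows "\<exists>r>0. \<forall>z\<in>cone_closure X. fst z < r \<longrightarrow> a < v z"
proof -
  have "\<forall>\<^sub>F r in at_right 0. ereal a < (INF z\<in>{z\<in>cone_closure X. 0 < fst z \<and> fst z < r}. ereal (v z))"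
    using assms unfolding has_lower_limit_t0_def by (intro order_tendstoD(1)) auto
  then obtain b where b: "b > 0"
    "\<And>r. 0 < r \<Longrightarrow> r < b \<Longrightarrow> ereal a < (INF z\<in>{z\<in>cone_closure X. 0 < fst z \<and> fst z < r}. ereal (v z))"
    unfolding eventually_at_right_field by blast
  have "a < v z" if z: "z \<in> cone_closure X" "fst z < b / 2" for z
  proof -
    have "ereal a < (INF z\<in>{z\<in>cone_closure X. 0 < fst z \<and> fst z < b / 2}. ereal (v z))"
      by (rule b(2)) (use b(1) in simp_all)
    also have "fst z > 0" using z(1) by (auto simp: cone_closure_def cone_dom_def cone_boundary_def)
    then have "(INF z\<in>{z\<in>cone_closure X. 0 < fst z \<and> fst z < b / 2}. ereal (v z)) \<le> ereal (v z)"
      using z by (intro INF_lower) auto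
    finally show ?thesis by simp
  qed
  then show ?thesis using b(1) by (intro exI[of _ "b / 2"]) auto
qed

text \<open>Near \<open>t = 0\<close> the upper limit controls \<open>u\<close>; the remaining part
  of the closure is compact.\<close>

lemma usc_on_cone_closure_bounded_above:
  assumes X: "open X" "bounded X" and u: "usc_on (cone_closure X) u" "has_upper_limit_t0 X u L"
  shows "\<exists>C. \<forall>z\<in>cone_closure X. u z \<le> C"
proof -
  obtain r where r: "r > 0" "\<And>z. z \<in> cone_closure X \<Longrightarrow> fst z < r \<Longrightarrow> u z < L + 1"
    using has_upper_limit_t0D[OF u(2), of "L + 1"] by auto
  let ?K = "{r..1} \<times> closure X"
  have K: "compact ?K" using X by (intro compact_Times compact_Icc) (simp add: compact_closure)
  have "usc_on ?K u" by (rule usc_on_subset[OF u(1)]) (use r(1) in \<open>auto simp: cone_closure_eq X\<close>)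
  then obtain C where C: "\<And>z. z \<in> ?K \<Longrightarrow> u z \<le> C"
    using usc_on_attains_max[OF K, of u] by (cases "?K = {}") auto
  have "u z \<le> max C (L + 1)" if "z \<in> cone_closure X" for z
    using r(2)[OF that] C[of z] that by (cases "fst z < r") (auto simp: cone_closure_eq X mem_Times_iff)
  then show ?thesis by blast
qed

theorem theorem1p4:
  fixes X :: "(real ^ 'm::finite) set"
    and p \<omega> L M :: real
    and f u v :: "real \<times> (real ^ 'm) \<Rightarrow> real"
  assumes "p \<ge> 2"
    and "open X" and "connected X" and "bounded X" and "smooth_boundary X"
    and "continuous_on (cone_closure X) f"
    and "\<omega> > 0" and "\<forall>(t, x)\<in>cone_dom X. t powr p * f (t, x) \<ge> \<omega>"
    and "usc_on (cone_closure X) u" and "viscosity_subsolution X p f u"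
    and "has_upper_limit_t0 X u L"
    and "lsc_on (cone_closure X) v" and "viscosity_supersolution X p f v"
    and "has_lower_limit_t0 X v M"
    and "L \<le> M"
    and "bdd_above (v ` cone_closure X)"
    and "\<forall>z\<in>cone_boundary X. u z \<le> v z"
  shows "\<forall>z\<in>cone_dom X. u z \<le> v z"
proof (rule ballI, rule ccontr)
  fix z1 assume z1: "z1 \<in> cone_dom X" and "\<not> u z1 \<le> v z1"
  define \<theta> where "\<theta> = u z1 - v z1"
  have \<theta>: "\<theta> > 0" using \<open>\<not> u z1 \<le> v z1\<close> by (simp add: \<theta>_def)
  obtain C0 where C0: "\<And>z. z \<in> cone_closure X \<Longrightarrow> u z \<le> C0"
    using usc_on_cone_closure_bounded_above[OF assms(2,4,9,11)] by blast
  \<comment> \<open>This bounds \<open>u\<close> from above on the closure and from below at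
    \<open>z1\<close>; the summand 1 makes it positive. With
    \<open>\<eta> * C = \<theta> / 4\<close>, the scaling costs at most \<open>\<theta> / 4\<close>
    both on \<open>K - N\<close> and at \<open>z1\<close>.\<close>
  define C where "C = max \<bar>C0\<bar> \<bar>u z1\<bar> + 1"
  have C: "C > 0" "- C \<le> u z1" "\<And>z. z \<in> cone_closure X \<Longrightarrow> u z \<le> C"
    using C0 by (auto simp: C_def max_def) (smt (verit))+
  define \<eta> where "\<eta> = \<theta> / (4 * C)"
  have \<eta>: "\<eta> > 0" "\<eta> * C = \<theta> / 4" using \<theta> C(1) by (simp_all add: \<eta>_def)
  have \<eta>u: "\<eta> * u z \<le> \<theta> / 4" if "z \<in> cone_closure X" for z
    using mult_left_mono[OF C(3)[OF that], of \<eta>] \<eta> by linarith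
  define k where "k = 1 + \<eta>"
  have k: "k > 1" using \<eta> by (simp add: k_def)
  obtain ru where ru: "ru > 0" "\<And>z. z \<in> cone_closure X \<Longrightarrow> fst z < ru \<Longrightarrow> u z < L + \<theta> / 8"
    using has_upper_limit_t0D[OF assms(11), of "L + \<theta> / 8"] \<theta> by auto
  obtain rv where rv: "rv > 0" "\<And>z. z \<in> cone_closure X \<Longrightarrow> fst z < rv \<Longrightarrow> M - \<theta> / 8 < v z"
    using has_lower_limit_t0D[OF assms(14), of "M - \<theta> / 8"] \<theta> by auto
  \<comment> \<open>The set is cut at a level \<open>t = r\<close> where both one-sided limits are
    already effective and which lies below \<open>z1\<close>.\<close>
  define r where "r = min (min ru rv) (fst z1) / 2"
  have t1: "0 < fst z1" "fst z1 < 1" "snd z1 \<in> X" using z1 by (auto simp: cone_dom_def)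
  have r: "0 < r" "r < ru" "r < rv" "r < fst z1" using ru rv t1 by (auto simp: r_def)
  define K where "K = {ln r..0} \<times> closure X"
  define N where "N = {ln r<..<0} \<times> X"
  have K: "compact K"
    unfolding K_def using assms(4) by (intro compact_Times compact_Icc) (simp add: compact_closure)
  have N: "open N" "N \<subseteq> K" "N \<subseteq> {..<0} \<times> X"
    using assms(2) closure_subset[of X] by (auto simp: N_def K_def intro!: open_Times)
  have K_closure: "exp_coord ` K \<subseteq> cone_closure X"
    by (auto simp: K_def exp_coord_def cone_closure_eq assms(2))
  let ?g = "\<lambda>z. exp (fst z) powr p * f (exp_coord z)"
  have g_pos: "?g z > 0" if "z \<in> N" for z
  proof -
    have "exp_coord z \<in> cone_dom X" using N(3) that exp_coord_in_cone_dom by blast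
    then have "\<omega> \<le> ?g z" using assms(8) by (auto simp: exp_coord_def)
    then show ?thesis using assms(7) by simp
  qed
  have g_cont: "continuous_on N ?g"
  proof -
    have "continuous_on N (\<lambda>z. f (exp_coord z))"
      by (rule continuous_on_compose2[OF assms(6) continuous_on_exp_coord]) (use K_closure N(2) in auto)
    then show ?thesis by (intro continuous_intros) auto
  qed
  have kp: "k powr (p - 1) > 1" using k assms(1) by (simp add: gr_one_powr)
  \<comment> \<open>Outside \<open>N\<close> there are two cases. On the cut \<open>t = r\<close>
    the limits at 0 contribute at most \<open>\<theta> / 8\<close> each, and every other point
    belongs to \<open>cone_boundary X\<close>, where \<open>u\<close> is at most
    \<open>v\<close>.\<close>
  have bd: "k * u (exp_coord z) + - v (exp_coord z) \<le> \<theta> / 2" if z: "z \<in> K - N" for z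
  proof -
    have cl: "exp_coord z \<in> cone_closure X" using z K_closure by auto
    have "u (exp_coord z) - v (exp_coord z) \<le> \<theta> / 4"
    proof (cases "fst z = ln r")
      case True
      then have "fst (exp_coord z) = r" using r by simp
      then show ?thesis using ru(2)[OF cl] rv(2)[OF cl] r assms(15) by simp
    next
      case False
      then have "exp_coord z \<in> cone_boundary X"
        using z assms(2) by (auto simp: K_def N_def exp_coord_def cone_boundary_def frontier_def interior_open)
      then show ?thesis using assms(17) \<theta> by force
    qed
    then show ?thesis using \<eta>u[OF cl] by (simp add: k_def algebra_simps)
  qed
  have z1K: "log_coord z1 \<in> K"
    using t1 r closure_subset[of X] by (auto simp: K_def log_coord_def)
  have "k * u (exp_coord (log_coord z1)) + - v (exp_coord (log_coord z1)) \<le> \<theta> / 2"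
  proof (rule visc_subsol_sum_comparison[where z = "log_coord z1"
        and ?w1.0 = "\<lambda>z. k * u (exp_coord z)" and ?w2.0 = "\<lambda>z. - v (exp_coord z)"
        and ?h1.0 = "\<lambda>z. k powr (p - 1) * ?g z" and ?h2.0 = "\<lambda>z. - ?g z",
        OF plap_minus plap_regular_or_degenerate[OF assms(1)]])
    show "compact K" "open N" "N \<subseteq> K" "log_coord z1 \<in> K" by fact+
    show "usc_on K (\<lambda>z. k * u (exp_coord z))"
      using k by (intro usc_on_cmult usc_on_compose[OF assms(9) continuous_on_exp_coord K_closure]) simp
    show "usc_on K (\<lambda>z. - v (exp_coord z))"
      by (rule usc_on_compose[OF usc_on_uminus[OF assms(12)] continuous_on_exp_coord K_closure])
    show "visc_subsol (plap_coeff p) (plap_dir p) (plap_drift p) (\<lambda>z. k powr (p - 1) * ?g z) N (\<lambda>z. k * u (exp_coord z))"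
      using viscosity_subsolution_log_coord[OF assms(10,1,2) _ N(3)] k by simp
    show "visc_subsol (plap_coeff p) (plap_dir p) (plap_drift p) (\<lambda>z. - ?g z) N (\<lambda>z. - v (exp_coord z))"
      by (rule viscosity_supersolution_log_coord[OF assms(13,1,2) N(3)])
    show "continuous_on N (\<lambda>z. k powr (p - 1) * ?g z)" "continuous_on N (\<lambda>z. - ?g z)"
      by (intro continuous_on_mult continuous_on_const continuous_on_minus g_cont)+
    show "k powr (p - 1) * ?g z + - ?g z > 0" "k powr (p - 1) * ?g z > 0" if "z \<in> N" for z
      using mult_strict_right_mono[OF kp g_pos[OF that]] g_pos[OF that] by linarith+
    show "k * u (exp_coord z) + - v (exp_coord z) \<le> \<theta> / 2" if "z \<in> K - N" for z by (rule bd[OF that])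
  qed
  \<comment> \<open>The left-hand side is \<open>k * u z1 - v z1\<close>, which is at least
    \<open>3/4 * \<theta>\<close>.\<close>
  then have "\<theta> + \<eta> * u z1 \<le> \<theta> / 2"
    using t1 by (simp add: exp_log_coord k_def \<theta>_def algebra_simps)
  moreover have "- (\<theta> / 4) \<le> \<eta> * u z1"
    using mult_left_mono[OF C(2), of \<eta>] \<eta> by simp
  ultimately show False using \<theta> by simp
qed

end
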